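(* In the controlled branching process setting described in the context (with integer $m\ge1$, finite action set $\bar A$, action $a_*\in\bar A$, $\rho_*=\rho(a_* )=\min_{a\in\bar A}\rho(a)$, and $m_*$ as defined there), the following hold. (i) If $m_*=m+1$, then $\tilde f\in F_m(a_* )$ is optimal if and only if $(ep^{\tilde f}_i:1\le i\le m)$ is the unique solution of the system $$\begin{cases}x_i=\min\limits_{a\in A(i)}\Big\{\tilde p(0|i,a)+\sum\limits_{j=1}^{m-1}\tilde p(j|i,a)x_j+L(i,a)x_m\Big\}, & 1\le i\le m,\\ 0\le x_i\le 1, & 1\le i\le m,\end{cases}$$ and $ep^{\tilde f}_i=\rho_*^{\,i-m}\,ep^{\tilde f}_m$ for all $i\ge m+1$. (ii) If $m_*\le m$, then $\tilde f\in F_m(a_* )$ is optimal if and only if $(ep^{\tilde f}_i:1\le i\le m_*-1)$ is the unique solution of the system $$\begin{cases}x_i=\min\limits_{a\in A(i)}\Big\{\tilde p(0|i,a)+\sum\limits_{j=1}^{m_*-1}\tilde p(j|i,a)x_j\Big\}, & 1\le i\le m_*-1,\\ 0\le x_i\le 1, & 1\le i\le m_*-1,\end{cases}$$ and $ep^{\tilde f}_i=0$ for all $i\ge m_*$.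
   Context: Controlled branching process (CBP). The state space is $S=\mathbb Z_+=\{0,1,2,\dots\}$ and the target set is $B=\{0\}$. For each $i\in S$, $A(i)$ is a finite nonempty set of admissible actions and $A=\bigcup_iA(i)$. Each $a\in A$ has a branching mechanism $\{b_k(a):k\ge0\}$ of real numbers with $b_1(a)\le0$, $b_k(a)\ge0$ for $k\ne1$, $\sum_{k=0}^\infty b_k(a)=0$, and $\sum_{k=2}^\infty b_k(a)>0$. The transition rates are $q(j|i,a)=i\,b_{j-i+1}(a)$ if $j\ge i-1$ and $q(j|i,a)=0$ otherwise (so $0$ is absorbing). Put $q_i(a)=-q(i|i,a)$. There is an integer $m\ge1$ and a set $\bar A$ with $A(i)=\bar A$ for all $i\ge m$. Standing regularity assumption: there exist a function $R\ge1$ on $S$ and constants $c_0\ne0$, $b_0\ge0$, $L_0>0$ with $\sum_{j}q(j|i,a)R(j)\le c_0R(i)+b_0$ for all $i\in S$, $a\in A(i)$, and $\max_{a\in A(i)}q_i(a)\le L_0R(i)$ for all $i$ (this ensures non-explosion). Policies and extinction probabilities. $F$ is the set of deterministic stationary policies, i.e. maps $f:S\to A$ with $f(i)\in A(i)$. For $f\in F$, let $X$ be the continuous-time Markov chain with rates $q(j|i,f(i))$ and law $P^f$, let $\tau_0=\inf\{t\ge0:X(t)=0\}$, and $ep^f_i=P^f(\tau_0<\infty\mid X(0)=i)$. Let $ep^*_i=\min_{f\in F}ep^f_i$ for $i\ge1$. A policy $f$ is optimal if $ep^f_i=ep^*_i$ for all $i\ge1$. Generating functions. For $a\in\bar A$,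 $B(a;v)=\sum_{k=0}^\infty b_k(a)v^k$, $v\in[0,1]$, and $\rho(a)$ is the smallest nonnegative root of $B(a;v)=0$ (so $\rho(a)\in[0,1]$). Put $\rho_*=\min_{a\in\bar A}\rho(a)$, fix $a_*\in\bar A$ with $\rho(a_* )=\rho_*$, and let $F_m(a_* )=\{f\in F: f(i)=a_*\text{ for all }i\ge m+1\}$. Embedded chain. For $i\ge1$, $a\in A(i)$: $\tilde p(j|i,a)=q(j|i,a)/q_i(a)$ for $j\ne i$ and $\tilde p(i|i,a)=0$. For $1\le i\le m$, $a\in A(i)$: $L(i,a)=\sum_{j=m}^\infty\tilde p(j|i,a)\rho_*^{\,j-m}$, with the convention $0^0=1$. Definition of $m_*$. Let $\mathscr M=\{i:1\le i\le m,\ \min_{a\in A(i)}b_0(a)=0\}$. Then $m_*=\min\mathscr M$ if $\mathscr M\ne\emptyset$, and $m_*=m+1$ if $\mathscr M=\emptyset$. "Is the unique solution" means: it is a solution and the system has no other solution. *)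

theory Defs
  imports "HOL-Probability.Probability"
begin

section \<open>Continuous-time Markov chains on the natural numbers\<close>

text \<open>
  \<open>Q i j\<close> is the rate from \<open>i\<close> to \<open>j\<close>. The chain is given by the usual jump chain / holding
  time construction. A sample point is a stream of independent pairs \<open>(e, s)\<close>, one pair per jump:
  \<open>e\<close> is a standard exponential variable, and for every state \<open>i\<close> the value \<open>s i\<close> is drawn from the
  jump distribution of \<open>i\<close>. From a state \<open>i\<close> with \<open>Q i i \<noteq> 0\<close> the chain jumps to \<open>s i\<close> after the
  time \<open>e / - Q i i\<close>, which is exponential with parameter \<open>- Q i i\<close>. A state with \<open>Q i i = 0\<close> is
  kept forever.
\<close>

definition jump_pmf :: "(nat \<Rightarrow> nat \<Rightarrow> real) \<Rightarrow> nat \<Rightarrow> nat pmf" where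
  "jump_pmf Q i =
    (if Q i i = 0 then return_pmf i
     else embed_pmf (\<lambda>j. if j = i then 0 else Q i j / (- Q i i)))"

definition ctmc_space :: "(nat \<Rightarrow> nat \<Rightarrow> real) \<Rightarrow> (real \<times> (nat \<Rightarrow> nat)) stream measure" where
  "ctmc_space Q =
    stream_space (density lborel (exponential_density 1) \<Otimes>\<^sub>M
                  (\<Pi>\<^sub>M i\<in>UNIV. measure_pmf (jump_pmf Q i)))"

primrec jump_chain :: "nat \<Rightarrow> (real \<times> (nat \<Rightarrow> nat)) stream \<Rightarrow> nat \<Rightarrow> nat" where
  "jump_chain i \<omega> 0 = i"
| "jump_chain i \<omega> (Suc n) = snd (\<omega> !! n) (jump_chain i \<omega> n)"

definition holding_time ::
  "(nat \<Rightarrow> nat \<Rightarrow> real) \<Rightarrow> nat \<Rightarrow> (real \<times> (nat \<Rightarrow> nat)) stream \<Rightarrow> nat \<Rightarrow> ereal" where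
  "holding_time Q i \<omega> n =
    (let y = jump_chain i \<omega> n in
     if Q y y = 0 then \<infinity> else ereal (fst (\<omega> !! n) / (- Q y y)))"

definition jump_time ::
  "(nat \<Rightarrow> nat \<Rightarrow> real) \<Rightarrow> nat \<Rightarrow> (real \<times> (nat \<Rightarrow> nat)) stream \<Rightarrow> nat \<Rightarrow> ereal" where
  "jump_time Q i \<omega> n = (\<Sum>k<n. holding_time Q i \<omega> k)"

text \<open>
  The chain started in \<open>i\<close>, at time \<open>t \<ge> 0\<close>: it sits in the \<open>n\<close>-th state of the jump chain from
  the \<open>n\<close>-th jump time (inclusive) to the next one (exclusive). The value \<open>\<infinity>\<close> is a cemetery that is
  entered at the explosion time; it has probability zero for non-explosive rates.
\<close>

definition ctmc ::
  "(nat \<Rightarrow> nat \<Rightarrow> real) \<Rightarrow> nat \<Rightarrow> real \<Rightarrow> (real \<times> (nat \<Rightarrow> nat)) stream \<Rightarrow> enat" where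
  "ctmc Q i t \<omega> =
    (if \<exists>n. ereal t < jump_time Q i \<omega> (Suc n)
     then enat (jump_chain i \<omega> (LEAST n. ereal t < jump_time Q i \<omega> (Suc n)))
     else \<infinity>)"

definition hitting_time ::
  "(nat \<Rightarrow> nat \<Rightarrow> real) \<Rightarrow> nat \<Rightarrow> nat \<Rightarrow> (real \<times> (nat \<Rightarrow> nat)) stream \<Rightarrow> ereal" where
  "hitting_time Q i k \<omega> = Inf {ereal t |t. 0 \<le> t \<and> ctmc Q i t \<omega> = enat k}"


section \<open>Controlled branching processes\<close>

definition rate :: "('a \<Rightarrow> nat \<Rightarrow> real) \<Rightarrow> nat \<Rightarrow> nat \<Rightarrow> 'a \<Rightarrow> real" where
  "rate b j i a = (if i \<le> j + 1 then real i * b a (j + 1 - i) else 0)"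

definition exit_rate :: "('a \<Rightarrow> nat \<Rightarrow> real) \<Rightarrow> nat \<Rightarrow> 'a \<Rightarrow> real" where
  "exit_rate b i a = - rate b i i a"

text \<open>
  In \<open>regular\<close> the only possibly negative term of the series is the one with \<open>j = i\<close>, so
  an upper bound on the sum includes its convergence.
\<close>

definition regular :: "(nat \<Rightarrow> 'a set) \<Rightarrow> ('a \<Rightarrow> nat \<Rightarrow> real) \<Rightarrow> bool" where
  "regular A b \<longleftrightarrow>
    (\<exists>(R :: nat \<Rightarrow> real) (c0 :: real) (d0 :: real) (L0 :: real).
       (\<forall>i. R i \<ge> 1) \<and> c0 \<noteq> 0 \<and> d0 \<ge> 0 \<and> L0 > 0 \<and>
       (\<forall>i. \<forall>a\<in>A i. summable (\<lambda>j. rate b j i a * R j) \<and>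
                    (\<Sum>j. rate b j i a * R j) \<le> c0 * R i + d0) \<and>
       (\<forall>i. Max ((\<lambda>a. exit_rate b i a) ` A i) \<le> L0 * R i))"

locale controlled_branching =
  fixes A :: "nat \<Rightarrow> 'a set"
    and b :: "'a \<Rightarrow> nat \<Rightarrow> real"
    and m :: nat
    and Abar :: "'a set"
  assumes actions: "\<And>i. finite (A i) \<and> A i \<noteq> {}"
    and b_one: "\<And>a. a \<in> (\<Union>i. A i) \<Longrightarrow> b a 1 \<le> 0"
    and b_nonneg: "\<And>a k. a \<in> (\<Union>i. A i) \<Longrightarrow> k \<noteq> 1 \<Longrightarrow> b a k \<ge> 0"
    and b_sums: "\<And>a. a \<in> (\<Union>i. A i) \<Longrightarrow> b a sums 0"
    and b_branching: "\<And>a. a \<in> (\<Union>i. A i) \<Longrightarrow> (\<Sum>k. b a (k + 2)) > 0"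
    and m_pos: "m \<ge> 1"
    and actions_const: "\<And>i. i \<ge> m \<Longrightarrow> A i = Abar"
    and regularity: "regular A b"

definition policies :: "(nat \<Rightarrow> 'a set) \<Rightarrow> (nat \<Rightarrow> 'a) set" where
  "policies A = {f. \<forall>i. f i \<in> A i}"

definition ep :: "('a \<Rightarrow> nat \<Rightarrow> real) \<Rightarrow> (nat \<Rightarrow> 'a) \<Rightarrow> nat \<Rightarrow> real" where
  "ep b f i =
    (let Q = (\<lambda>i j. rate b j i (f i)) in
     measure (ctmc_space Q) {\<omega> \<in> space (ctmc_space Q). hitting_time Q i 0 \<omega> < \<infinity>})"

text \<open>
  The set of policies is infinite in general, so the minimum is written as an infimum; an optimal
  policy attains it simultaneously for all \<open>i \<ge> 1\<close>.
\<close>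

definition ep_min :: "(nat \<Rightarrow> 'a set) \<Rightarrow> ('a \<Rightarrow> nat \<Rightarrow> real) \<Rightarrow> nat \<Rightarrow> real" where
  "ep_min A b i = (INF f\<in>policies A. ep b f i)"

definition optimal :: "(nat \<Rightarrow> 'a set) \<Rightarrow> ('a \<Rightarrow> nat \<Rightarrow> real) \<Rightarrow> (nat \<Rightarrow> 'a) \<Rightarrow> bool" where
  "optimal A b f \<longleftrightarrow> (\<forall>i\<ge>1. ep b f i = ep_min A b i)"

definition gen_fun :: "('a \<Rightarrow> nat \<Rightarrow> real) \<Rightarrow> 'a \<Rightarrow> real \<Rightarrow> real" where
  "gen_fun b a v = (\<Sum>k. b a k * v ^ k)"

definition \<rho> :: "('a \<Rightarrow> nat \<Rightarrow> real) \<Rightarrow> 'a \<Rightarrow> real" where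
  "\<rho> b a = (LEAST v. 0 \<le> v \<and> v \<le> 1 \<and> gen_fun b a v = 0)"

definition rho_min :: "('a \<Rightarrow> nat \<Rightarrow> real) \<Rightarrow> 'a set \<Rightarrow> real" where
  "rho_min b Abar = Min (\<rho> b ` Abar)"

definition tail_policies :: "(nat \<Rightarrow> 'a set) \<Rightarrow> nat \<Rightarrow> 'a \<Rightarrow> (nat \<Rightarrow> 'a) set" where
  "tail_policies A m a = {f \<in> policies A. \<forall>i\<ge>m + 1. f i = a}"

definition ptilde :: "('a \<Rightarrow> nat \<Rightarrow> real) \<Rightarrow> nat \<Rightarrow> nat \<Rightarrow> 'a \<Rightarrow> real" where
  "ptilde b j i a = (if j = i then 0 else rate b j i a / exit_rate b i a)"

text \<open>In \<open>Lsum\<close> the series over \<open>j \<ge> m\<close> is indexed by \<open>k = j - m\<close>.\<close>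

definition Lsum :: "('a \<Rightarrow> nat \<Rightarrow> real) \<Rightarrow> nat \<Rightarrow> real \<Rightarrow> nat \<Rightarrow> 'a \<Rightarrow> real" where
  "Lsum b m r i a = (\<Sum>k. ptilde b (m + k) i a * r ^ k)"

definition m_star :: "(nat \<Rightarrow> 'a set) \<Rightarrow> ('a \<Rightarrow> nat \<Rightarrow> real) \<Rightarrow> nat \<Rightarrow> nat" where
  "m_star A b m =
    (let M = {i. 1 \<le> i \<and> i \<le> m \<and> Min ((\<lambda>a. b a 0) ` A i) = 0} in
     if M = {} then m + 1 else Min M)"

text \<open>A vector \<open>(x\<^sub>i : i \<in> I)\<close> is a function on \<open>nat\<close> of which only the values on \<open>I\<close> matter.\<close>

definition unique_solution_on :: "nat set \<Rightarrow> ((nat \<Rightarrow> real) \<Rightarrow> bool) \<Rightarrow> (nat \<Rightarrow> real) \<Rightarrow> bool" where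
  "unique_solution_on I P x \<longleftrightarrow> P x \<and> (\<forall>y. P y \<longrightarrow> (\<forall>i\<in>I. y i = x i))"

end

theory Submission
  imports Defs
begin

text \<open>
  Whether the chain reaches \<open>0\<close> is decided by its jump chain, so first-step analysis turns extinction
  probabilities into a problem about the linear operators \<open>step b i a\<close> (mean of a function after one
  jump from \<open>i\<close> under action \<open>a\<close>): \<open>ep b f\<close> is harmonic for \<open>f\<close> away from \<open>0\<close>, has value \<open>1\<close> at
  \<open>0\<close>, and is the least nonnegative supersolution (\<open>ep_first_step\<close>, \<open>ep_le_supersolution\<close>). After
  that the argument is analytic and rests on two facts.

  Leastness bounds extinction probabilities from above. It gives policy improvement: if some action
  at \<open>i\<close> made the one-step mean of \<open>ep b f\<close> smaller than \<open>ep b f i\<close>, then \<open>ep b f\<close> would be a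
  supersolution, strict at \<open>i\<close>, for the policy changed at \<open>i\<close>; so an optimal policy satisfies the
  optimality equation (\<open>optimal_imp_optimality_equation\<close>).

  A minimum principle bounds them from below. The chain moves down by at most one state at a time,
  and it does so with positive probability when \<open>b a 0 > 0\<close>. Hence a superharmonic function that
  attains its global minimum at a state takes the same value at all states below it, down to the
  boundary (\<open>minimum_propagates_down\<close>). Applied to the difference of two solutions of the system, this
  yields uniqueness; applied to \<open>ep b g - ep b f\<close> for an arbitrary policy \<open>g\<close>, it shows that a
  solution \<open>ep b f\<close> of the system is optimal.

  The one real difficulty is that a minimum need not be attained on the infinite state space when
  \<open>m_star A b m = m + 1\<close>. Since \<open>step b i a\<close> changes \<open>j \<mapsto> s ^ j\<close> by a nonnegative multiple of
  \<open>gen_fun b a s\<close>, this function is subharmonic beyond \<open>m\<close> for every \<open>s\<close> up to the least extinction root \<open>r\<close>, and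
  for \<open>s = r\<close> it is harmonic under \<open>a_star\<close>. If \<open>r < 1\<close>, the functions in question are bounded
  below by a multiple of \<open>- r ^ j\<close>, which vanishes at infinity. If \<open>r = 1\<close>, adding a large multiple
  of \<open>1 - s ^ j\<close> with \<open>s < 1\<close> makes them positive near infinity, and \<open>s \<rightarrow> 1\<close> removes the correction
  (\<open>minimum_principle_geometric\<close>). The same principle gives the geometric tail of \<open>ep b f\<close>
  for tail policies (\<open>ep_geometric_tail\<close>), which is what collapses the infinite optimality equation to
  the finite system with the coefficient \<open>Lsum\<close>.

  When \<open>m_star A b m \<le> m\<close>, an action with \<open>b a 0 = 0\<close> at \<open>m_star A b m\<close> blocks all descent, so the
  optimal value vanishes from there on (\<open>optimal_imp_ep_eq_0\<close>), and only the finitely many states below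
  are left.
\<close>

section \<open>First-step analysis of the jump chain\<close>

lemma jump_chain_Stream: "jump_chain i (x ## \<omega>) (Suc n) = jump_chain (snd x i) \<omega> n"
  by (induction n) auto

definition jump_law :: "(nat \<Rightarrow> nat \<Rightarrow> real) \<Rightarrow> (real \<times> (nat \<Rightarrow> nat)) measure" where
  "jump_law Q = density lborel (exponential_density 1) \<Otimes>\<^sub>M
                  (\<Pi>\<^sub>M i\<in>UNIV. measure_pmf (jump_pmf Q i))"

lemma ctmc_space_eq: "ctmc_space Q = stream_space (jump_law Q)"
  by (simp add: ctmc_space_def jump_law_def)

lemma prob_space_jump_law: "prob_space (jump_law Q)"
  unfolding jump_law_def
  by (intro prob_space_pair prob_space_exponential_density prob_space_PiM
      prob_space_measure_pmf) auto

lemma prob_space_ctmc_space: "prob_space (ctmc_space Q)"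
  unfolding ctmc_space_eq by (rule prob_space.prob_space_stream_space[OF prob_space_jump_law])

lemma measurable_jump [measurable]:
  "(\<lambda>x. snd x i) \<in> measurable (jump_law Q) (count_space UNIV)"
proof -
  have "(\<lambda>x. snd x i) \<in> measurable (jump_law Q) (measure_pmf (jump_pmf Q i))"
    unfolding jump_law_def by measurable
  then show ?thesis by simp
qed

lemma nn_integral_jump_law:
  "(\<integral>\<^sup>+x. g (snd x i) \<partial>jump_law Q) = (\<integral>\<^sup>+j. g j \<partial>measure_pmf (jump_pmf Q i))"
proof -
  let ?E = "density lborel (exponential_density 1)"
  let ?P = "\<Pi>\<^sub>M i\<in>UNIV. measure_pmf (jump_pmf Q i)"
  interpret E: prob_space ?E by (rule prob_space_exponential_density) simp
  interpret P: prob_space ?P by (intro prob_space_PiM prob_space_measure_pmf)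
  have [measurable]: "(\<lambda>x. g (snd x i)) \<in> borel_measurable (?E \<Otimes>\<^sub>M ?P)"
    by (rule measurable_compose[OF measurable_jump[unfolded jump_law_def], of g]) simp
  have "(\<integral>\<^sup>+x. g (snd x i) \<partial>jump_law Q) = (\<integral>\<^sup>+e. \<integral>\<^sup>+s. g (s i) \<partial>?P \<partial>?E)"
    unfolding jump_law_def by (subst P.nn_integral_fst[symmetric]) simp_all
  also have "\<dots> = (\<integral>\<^sup>+s. g (s i) \<partial>?P)"
    by (simp add: E.emeasure_space_1 del: space_density)
  also have "\<dots> = (\<integral>\<^sup>+j. g j \<partial>distr ?P (measure_pmf (jump_pmf Q i)) (\<lambda>s. s i))"
    by (subst nn_integral_distr) auto
  also have "\<dots> = (\<integral>\<^sup>+j. g j \<partial>measure_pmf (jump_pmf Q i))"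
    by (subst distr_PiM_component) (auto intro: prob_space_measure_pmf)
  finally show ?thesis .
qed

lemma measurable_jump_chain [measurable]:
  "(\<lambda>\<omega>. jump_chain i \<omega> n) \<in> measurable (ctmc_space Q) (count_space UNIV)"
proof (induction n)
  case 0
  then show ?case by simp
next
  case (Suc n)
  have "(\<lambda>\<omega>. snd (\<omega> !! n) j) \<in> measurable (ctmc_space Q) (count_space UNIV)" for j
    unfolding ctmc_space_eq
    by (rule measurable_compose[OF measurable_snth measurable_jump])
  then show ?case
    by (simp add: measurable_compose_countable[OF _ Suc, of "\<lambda>j \<omega>. snd (\<omega> !! n) j"])
qed

text \<open>
  The Markov property at the first jump, for events that depend on the state after it and on the
  remaining stream. The families \<open>hits_within Q n\<close> and \<open>hits Q\<close> are both instances.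
\<close>

lemma emeasure_after_first_jump:
  assumes S: "\<And>j. S j \<in> sets (ctmc_space Q)" and X: "X \<in> sets (ctmc_space Q)"
    and X_iff: "\<And>x \<omega>. \<omega> \<in> space (ctmc_space Q) \<Longrightarrow> x ## \<omega> \<in> X \<longleftrightarrow> \<omega> \<in> S (snd x i)"
  shows "emeasure (ctmc_space Q) X =
           (\<Sum>j. ennreal (pmf (jump_pmf Q i) j) * emeasure (ctmc_space Q) (S j))"
proof -
  let ?M = "ctmc_space Q"
  have "emeasure ?M X = (\<integral>\<^sup>+x. emeasure ?M {\<omega> \<in> space ?M. x ## \<omega> \<in> X} \<partial>jump_law Q)"
    using prob_space.emeasure_stream_space[OF prob_space_jump_law] X
    unfolding ctmc_space_eq by blast
  also have "\<dots> = (\<integral>\<^sup>+x. emeasure ?M (S (snd x i)) \<partial>jump_law Q)"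
  proof (rule nn_integral_cong)
    fix x
    have "{\<omega> \<in> space ?M. x ## \<omega> \<in> X} = S (snd x i)"
      using X_iff sets.sets_into_space[OF S] by blast
    then show "emeasure ?M {\<omega> \<in> space ?M. x ## \<omega> \<in> X} = emeasure ?M (S (snd x i))" by simp
  qed
  also have "\<dots> = (\<integral>\<^sup>+j. emeasure ?M (S j) \<partial>measure_pmf (jump_pmf Q i))"
    by (rule nn_integral_jump_law)
  also have "\<dots> = (\<Sum>j. ennreal (pmf (jump_pmf Q i) j) * emeasure ?M (S j))"
    by (simp add: nn_integral_measure_pmf nn_integral_count_space_nat)
  finally show ?thesis .
qed

definition hits_within :: "(nat \<Rightarrow> nat \<Rightarrow> real) \<Rightarrow> nat \<Rightarrow> nat \<Rightarrow> (real \<times> (nat \<Rightarrow> nat)) stream set" where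
  "hits_within Q n i = {\<omega> \<in> space (ctmc_space Q). \<exists>k\<le>n. jump_chain i \<omega> k = 0}"

definition hits :: "(nat \<Rightarrow> nat \<Rightarrow> real) \<Rightarrow> nat \<Rightarrow> (real \<times> (nat \<Rightarrow> nat)) stream set" where
  "hits Q i = {\<omega> \<in> space (ctmc_space Q). \<exists>k. jump_chain i \<omega> k = 0}"

lemma sets_hits_within [measurable]: "hits_within Q n i \<in> sets (ctmc_space Q)"
  unfolding hits_within_def by measurable

lemma sets_hits [measurable]: "hits Q i \<in> sets (ctmc_space Q)"
  unfolding hits_def by measurable

lemma emeasure_hits_within_Suc:
  assumes "i \<noteq> 0"
  shows "emeasure (ctmc_space Q) (hits_within Q (Suc n) i) =
           (\<Sum>j. ennreal (pmf (jump_pmf Q i) j) * emeasure (ctmc_space Q) (hits_within Q n j))"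
proof (rule emeasure_after_first_jump)
  fix x :: "real \<times> (nat \<Rightarrow> nat)" and \<omega>
  assume "\<omega> \<in> space (ctmc_space Q)"
  have "x \<in> space (jump_law Q)"
    by (simp add: jump_law_def space_pair_measure space_PiM)
  have "(\<exists>k\<le>Suc n. jump_chain i (x ## \<omega>) k = 0) \<longleftrightarrow>
      (\<exists>k\<le>n. jump_chain i (x ## \<omega>) (Suc k) = 0)"
    using assms by (metis Suc_le_mono jump_chain.simps(1) not0_implies_Suc)
  then show "x ## \<omega> \<in> hits_within Q (Suc n) i \<longleftrightarrow> \<omega> \<in> hits_within Q n (snd x i)"
    using \<open>\<omega> \<in> space (ctmc_space Q)\<close> \<open>x \<in> space (jump_law Q)\<close>
    by (auto simp: hits_within_def jump_chain_Stream ctmc_space_eq space_stream_space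
        simp del: jump_chain.simps(2))
qed auto

lemma emeasure_hits_first_step:
  assumes "i \<noteq> 0"
  shows "emeasure (ctmc_space Q) (hits Q i) =
           (\<Sum>j. ennreal (pmf (jump_pmf Q i) j) * emeasure (ctmc_space Q) (hits Q j))"
proof (rule emeasure_after_first_jump)
  fix x :: "real \<times> (nat \<Rightarrow> nat)" and \<omega>
  assume "\<omega> \<in> space (ctmc_space Q)"
  have "x \<in> space (jump_law Q)"
    by (simp add: jump_law_def space_pair_measure space_PiM)
  have "(\<exists>k. jump_chain i (x ## \<omega>) k = 0) \<longleftrightarrow>
      (\<exists>k. jump_chain i (x ## \<omega>) (Suc k) = 0)"
    using assms by (metis jump_chain.simps(1) not0_implies_Suc)
  then show "x ## \<omega> \<in> hits Q i \<longleftrightarrow> \<omega> \<in> hits Q (snd x i)"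
    using \<open>\<omega> \<in> space (ctmc_space Q)\<close> \<open>x \<in> space (jump_law Q)\<close>
    by (auto simp: hits_def jump_chain_Stream ctmc_space_eq space_stream_space
        simp del: jump_chain.simps(2))
qed auto

text \<open>
  By induction on \<open>n\<close>, a supersolution dominates the probability of hitting \<open>0\<close> within \<open>n\<close> jumps;
  continuity from below does the rest.
\<close>

lemma emeasure_hits_le_supersolution:
  fixes x :: "nat \<Rightarrow> ennreal"
  assumes "1 \<le> x 0"
    and super: "\<And>i. i \<noteq> 0 \<Longrightarrow> (\<Sum>j. ennreal (pmf (jump_pmf Q i) j) * x j) \<le> x i"
  shows "emeasure (ctmc_space Q) (hits Q i) \<le> x i"
proof -
  interpret prob_space "ctmc_space Q" by (rule prob_space_ctmc_space)
  have within: "emeasure (ctmc_space Q) (hits_within Q n i) \<le> x i" for n i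
  proof (induction n arbitrary: i)
    case 0
    then show ?case
      using \<open>1 \<le> x 0\<close> emeasure_le_1 order_trans by (cases "i = 0") (auto simp: hits_within_def)
  next
    case (Suc n)
    show ?case
    proof (cases "i = 0")
      case True
      then show ?thesis using \<open>1 \<le> x 0\<close> emeasure_le_1 order_trans by blast
    next
      case False
      then have "emeasure (ctmc_space Q) (hits_within Q (Suc n) i) =
          (\<Sum>j. ennreal (pmf (jump_pmf Q i) j) * emeasure (ctmc_space Q) (hits_within Q n j))"
        by (rule emeasure_hits_within_Suc)
      also have "\<dots> \<le> (\<Sum>j. ennreal (pmf (jump_pmf Q i) j) * x j)"
        by (intro suminf_le mult_left_mono Suc) auto
      also have "\<dots> \<le> x i" by (rule super[OF False])
      finally show ?thesis .
    qed
  qed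
  have "hits Q i = (\<Union>n. hits_within Q n i)"
    by (auto simp: hits_def hits_within_def)
  moreover have "incseq (\<lambda>n. hits_within Q n i)"
    unfolding hits_within_def by (intro monoI Collect_mono) (meson order_trans)
  ultimately have "emeasure (ctmc_space Q) (hits Q i) =
      (SUP n. emeasure (ctmc_space Q) (hits_within Q n i))"
    by (subst SUP_emeasure_incseq) auto
  also have "\<dots> \<le> x i" by (intro SUP_least within)
  finally show ?thesis .
qed

text \<open>
  Up to the first visit to \<open>0\<close> all holding times are finite, and the holding time in \<open>0\<close> is infinite.
  So the equivalence holds on every path, without a null set to discard.
\<close>

lemma hitting_time_finite_iff:
  assumes Q0: "\<And>i. Q i i = 0 \<longleftrightarrow> i = 0"
  shows "hitting_time Q i 0 \<omega> < \<infinity> \<longleftrightarrow> (\<exists>n. jump_chain i \<omega> n = 0)"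
proof
  assume "hitting_time Q i 0 \<omega> < \<infinity>"
  then have "\<exists>x \<in> {ereal t |t. 0 \<le> t \<and> ctmc Q i t \<omega> = enat 0}. x < \<infinity>"
    unfolding hitting_time_def Inf_less_iff .
  then obtain t where "ctmc Q i t \<omega> = enat 0" by auto
  then show "\<exists>n. jump_chain i \<omega> n = 0"
    by (auto simp: ctmc_def split: if_splits)
next
  assume "\<exists>n. jump_chain i \<omega> n = 0"
  define n where "n = (LEAST n. jump_chain i \<omega> n = 0)"
  have n: "jump_chain i \<omega> n = 0"
    unfolding n_def by (rule LeastI_ex) fact
  have before: "jump_chain i \<omega> k \<noteq> 0" if "k < n" for k
    using that not_less_Least unfolding n_def by blast
  define T where "T k = (\<Sum>l<k. fst (\<omega> !! l) / (- Q (jump_chain i \<omega> l) (jump_chain i \<omega> l)))" for k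
  have T: "jump_time Q i \<omega> k = ereal (T k)" if "k \<le> n" for k
    unfolding jump_time_def T_def sum_ereal[symmetric]
    using that by (intro sum.cong) (auto simp: holding_time_def Let_def Q0 before)
  have infinite: "jump_time Q i \<omega> (Suc n) = \<infinity>"
    using T[of n] by (simp add: jump_time_def holding_time_def n Q0)
  \<comment> \<open>The maximum of all earlier jump times, and not just \<open>T n\<close>: a sample point may have negative clocks, so \<open>T\<close> need not be monotone.\<close>
  define t where "t = Max (insert 0 (T ` {..n}))"
  have "0 \<le> t" unfolding t_def by (rule Max_ge) auto
  have t: "T k \<le> t" if "k \<le> n" for k
    using that unfolding t_def by (intro Max_ge) auto
  have "(LEAST k. ereal t < jump_time Q i \<omega> (Suc k)) = n"
  proof (rule Least_equality)
    show "ereal t < jump_time Q i \<omega> (Suc n)" by (simp add: infinite)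
    show "n \<le> k" if "ereal t < jump_time Q i \<omega> (Suc k)" for k
    proof (rule ccontr)
      assume "\<not> n \<le> k"
      then have "jump_time Q i \<omega> (Suc k) \<le> ereal t" using T[of "Suc k"] t[of "Suc k"] by simp
      then show False using that by simp
    qed
  qed
  then have "ctmc Q i t \<omega> = enat 0"
    using infinite n by (auto simp: ctmc_def intro!: exI[of _ n])
  then have "hitting_time Q i 0 \<omega> \<le> ereal t"
    unfolding hitting_time_def using \<open>0 \<le> t\<close> by (intro Inf_lower) auto
  then show "hitting_time Q i 0 \<omega> < \<infinity>" by (rule le_less_trans) simp
qed

section \<open>The one-step operator of the embedded chain\<close>

definition step :: "('a \<Rightarrow> nat \<Rightarrow> real) \<Rightarrow> nat \<Rightarrow> 'a \<Rightarrow> (nat \<Rightarrow> real) \<Rightarrow> real" where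
  "step b i a x = (\<Sum>j. ptilde b j i a * x j)"

context controlled_branching
begin

lemma action_in_Union: "a \<in> A i \<Longrightarrow> a \<in> (\<Union>i. A i)"
  by blast

lemma b_summable: "a \<in> A i \<Longrightarrow> summable (b a)"
  using b_sums[OF action_in_Union] by (rule sums_summable)

lemma b_one_neg:
  assumes "a \<in> A i"
  shows "b a 1 < 0"
proof -
  have "0 = (\<Sum>k. b a (k + 2)) + (b a 0 + b a 1)"
    using suminf_split_initial_segment[OF b_summable[OF assms], of 2]
      sums_unique[OF b_sums[OF action_in_Union[OF assms]]]
    by (simp add: numeral_2_eq_2)
  moreover have "b a 0 \<ge> 0" by (rule b_nonneg[OF action_in_Union[OF assms]]) simp
  ultimately show ?thesis using b_branching[OF action_in_Union[OF assms]] by linarith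
qed

lemma b_zero_nonneg: "a \<in> A i \<Longrightarrow> 0 \<le> b a 0"
  by (rule b_nonneg[OF action_in_Union]) auto

lemma ptilde_shift:
  assumes "0 < i" "a \<in> A i"
  shows "ptilde b (k + (i - 1)) i a = (if k = 1 then 0 else b a k / (- b a 1))"
  using assms by (auto simp: ptilde_def exit_rate_def rate_def Suc_diff_le)

lemma ptilde_pred: "0 < i \<Longrightarrow> a \<in> A i \<Longrightarrow> ptilde b (i - 1) i a = b a 0 / (- b a 1)"
  using ptilde_shift[of i a 0] by simp

lemma ptilde_below: "j + 1 < i \<Longrightarrow> ptilde b j i a = 0"
  by (simp add: ptilde_def rate_def)

lemma ptilde_nonneg:
  assumes "0 < i" "a \<in> A i"
  shows "0 \<le> ptilde b j i a"
proof (cases "j + 1 < i")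
  case True
  then show ?thesis by (simp add: ptilde_below)
next
  case False
  then have "j = (j - (i - 1)) + (i - 1)" by simp
  then have "ptilde b j i a =
      (if j - (i - 1) = 1 then 0 else b a (j - (i - 1)) / (- b a 1))"
    using ptilde_shift[OF assms] by metis
  moreover have "b a (j - (i - 1)) \<ge> 0" if "j - (i - 1) \<noteq> 1"
    using b_nonneg[OF action_in_Union[OF assms(2)] that] .
  ultimately show ?thesis using b_one_neg[OF assms(2)] by (auto intro: divide_nonneg_neg)
qed

lemma ptilde_pred_pos:
  assumes "0 < i" "a \<in> A i" "0 < b a 0"
  shows "0 < ptilde b (i - 1) i a"
  using assms b_one_neg[OF assms(2)] by (simp add: ptilde_pred divide_pos_neg del: One_nat_def)

lemma b_power_summable:
  assumes "a \<in> A i" "0 \<le> s" "s \<le> 1"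
  shows "summable (\<lambda>k. b a k * s ^ k)"
proof -
  have "summable (\<lambda>k. b a (k + 2) * s ^ (k + 2))"
  proof (rule summable_comparison_test)
    show "summable (\<lambda>k. b a (k + 2))"
      using b_summable[OF assms(1)] by (subst summable_iff_shift)
    have "norm (b a (k + 2) * s ^ (k + 2)) \<le> b a (k + 2)" for k
    proof -
      have "0 \<le> b a (k + 2)" by (rule b_nonneg[OF action_in_Union[OF assms(1)]]) simp
      moreover have "s ^ (k + 2) \<le> 1" "0 \<le> s ^ (k + 2)" using assms by (intro power_le_one zero_le_power; simp)+
      ultimately show ?thesis by (simp only: real_norm_def abs_mult abs_of_nonneg mult_left_le)
    qed
    then show "\<exists>N. \<forall>k\<ge>N. norm (b a (k + 2) * s ^ (k + 2)) \<le> b a (k + 2)" by blast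
  qed
  then show ?thesis by (subst (asm) summable_iff_shift)
qed

text \<open>
  Powers are the eigenfunctions that make branching chains tractable: the defect of \<open>j \<mapsto> s ^ j\<close>
  from harmonicity is the generating function of the action, so it is harmonic at a root, and
  subharmonic for every \<open>s\<close> at which the generating function is nonnegative.
\<close>

lemma ptilde_power_sums:
  assumes "0 < i" "a \<in> A i" "0 \<le> s" "s \<le> 1"
  shows "(\<lambda>j. ptilde b j i a * s ^ j) sums (s ^ i + s ^ (i - 1) * gen_fun b a s / (- b a 1))"
proof -
  have "(\<lambda>k. b a k * s ^ k) sums gen_fun b a s"
    unfolding gen_fun_def by (intro summable_sums b_power_summable[OF assms(2-)])
  moreover have "(\<lambda>k. if k = 1 then b a 1 * s else 0) sums (b a 1 * s)"
    using sums_single[of 1 "\<lambda>_. b a 1 * s"] by simp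
  ultimately have "(\<lambda>k. b a k * s ^ k - (if k = 1 then b a 1 * s else 0)) sums
      (gen_fun b a s - b a 1 * s)"
    by (rule sums_diff)
  then have "(\<lambda>k. s ^ (i - 1) / (- b a 1) * (b a k * s ^ k - (if k = 1 then b a 1 * s else 0))) sums
      (s ^ (i - 1) / (- b a 1) * (gen_fun b a s - b a 1 * s))"
    by (rule sums_mult)
  moreover have "s ^ (i - 1) / (- b a 1) * (b a k * s ^ k - (if k = 1 then b a 1 * s else 0)) =
      ptilde b (k + (i - 1)) i a * s ^ (k + (i - 1))" for k
    by (simp add: ptilde_shift[OF assms(1,2)] power_add del: One_nat_def)
  moreover have "s ^ (i - 1) / (- b a 1) * (gen_fun b a s - b a 1 * s) =
      s ^ i + s ^ (i - 1) * gen_fun b a s / (- b a 1)"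
    using b_one_neg[OF assms(2)] power_minus_mult[OF assms(1), of s]
    by (simp add: field_simps)
  ultimately have "(\<lambda>k. ptilde b (k + (i - 1)) i a * s ^ (k + (i - 1))) sums
      (s ^ i + s ^ (i - 1) * gen_fun b a s / (- b a 1))"
    by simp
  then show ?thesis
    by (subst (asm) sums_zero_iff_shift) (auto simp: ptilde_below)
qed

lemma gen_fun_one: "a \<in> A i \<Longrightarrow> gen_fun b a 1 = 0"
  using b_sums[OF action_in_Union] by (simp add: gen_fun_def sums_iff)

lemma ptilde_sums_one:
  assumes "0 < i" "a \<in> A i"
  shows "(\<lambda>j. ptilde b j i a) sums 1"
  using ptilde_power_sums[OF assms, of 1] gen_fun_one[OF assms(2)] by simp

lemma step_power:
  assumes "0 < i" "a \<in> A i" "0 \<le> s" "s \<le> 1"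
  shows "step b i a (\<lambda>j. s ^ j) = s ^ i + s ^ (i - 1) * gen_fun b a s / (- b a 1)"
  unfolding step_def using ptilde_power_sums[OF assms] by (simp add: sums_iff)

lemma step_const: "0 < i \<Longrightarrow> a \<in> A i \<Longrightarrow> step b i a (\<lambda>j. c) = c"
  unfolding step_def using sums_mult2[OF ptilde_sums_one, of i a c] by (simp add: sums_iff)

lemma summable_step:
  assumes "0 < i" "a \<in> A i" "bounded (range x)"
  shows "summable (\<lambda>j. ptilde b j i a * x j)"
proof -
  obtain C where C: "\<bar>x j\<bar> \<le> C" for j
    using assms(3) by (auto simp: bounded_iff)
  show ?thesis
  proof (rule summable_comparison_test)
    show "summable (\<lambda>j. ptilde b j i a * C)"
      using ptilde_sums_one[OF assms(1,2)] by (intro summable_mult2) (rule sums_summable)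
    show "\<exists>N. \<forall>j\<ge>N. norm (ptilde b j i a * x j) \<le> ptilde b j i a * C"
      using C ptilde_nonneg[OF assms(1,2)] by (auto simp: abs_mult intro!: mult_left_mono)
  qed
qed

lemma step_mono:
  assumes "0 < i" "a \<in> A i" "bounded (range x)" "bounded (range y)"
    and "\<And>j. i \<le> j + 1 \<Longrightarrow> x j \<le> y j"
  shows "step b i a x \<le> step b i a y"
  unfolding step_def
proof (rule suminf_le)
  show "ptilde b j i a * x j \<le> ptilde b j i a * y j" for j
    using assms(5) ptilde_nonneg[OF assms(1,2)]
    by (cases "i \<le> j + 1") (auto simp: ptilde_below intro: mult_left_mono)
qed (intro summable_step assms)+

lemma step_cong:
  assumes "\<And>j. i \<le> j + 1 \<Longrightarrow> x j = y j"
  shows "step b i a x = step b i a y"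
  unfolding step_def
proof (rule suminf_cong)
  show "ptilde b j i a * x j = ptilde b j i a * y j" for j
    using assms by (cases "i \<le> j + 1") (auto simp: ptilde_below)
qed

lemma step_add:
  assumes "0 < i" "a \<in> A i" "bounded (range x)" "bounded (range y)"
  shows "step b i a (\<lambda>j. x j + y j) = step b i a x + step b i a y"
  unfolding step_def
  using suminf_add[OF summable_step summable_step, OF assms(1-3) assms(1,2,4)]
  by (simp add: distrib_left)

lemma step_cmult:
  assumes "0 < i" "a \<in> A i" "bounded (range x)"
  shows "step b i a (\<lambda>j. c * x j) = c * step b i a x"
  unfolding step_def
  using suminf_mult[OF summable_step[OF assms], of c] by (simp add: mult.left_commute)

lemma step_diff:
  assumes "0 < i" "a \<in> A i" "bounded (range x)" "bounded (range y)"
  shows "step b i a (\<lambda>j. x j - y j) = step b i a x - step b i a y"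
  unfolding step_def
  using suminf_diff[OF summable_step summable_step, OF assms(1-3) assms(1,2,4)]
  by (simp add: right_diff_distrib)

section \<open>Extinction probabilities as least supersolutions\<close>

context
  fixes f :: "nat \<Rightarrow> 'a"
  assumes f: "f \<in> policies A"
begin

lemma policy_action: "f i \<in> A i"
  using f by (simp add: policies_def)

lemma rate_diag_zero_iff: "rate b i i (f i) = 0 \<longleftrightarrow> i = 0"
  using b_one_neg[OF policy_action, of i] by (auto simp: rate_def)

lemma pmf_jump_policy:
  assumes "0 < i"
  shows "pmf (jump_pmf (\<lambda>i j. rate b j i (f i)) i) j = ptilde b j i (f i)"
proof -
  have "jump_pmf (\<lambda>i j. rate b j i (f i)) i = embed_pmf (\<lambda>j. ptilde b j i (f i))"
    using assms
    by (simp add: jump_pmf_def rate_diag_zero_iff ptilde_def exit_rate_def cong: if_cong)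
  moreover have "(\<integral>\<^sup>+j. ennreal (ptilde b j i (f i)) \<partial>count_space UNIV) = 1"
    using ptilde_sums_one[OF assms policy_action] ptilde_nonneg[OF assms policy_action]
    by (simp add: nn_integral_count_space_nat suminf_ennreal_eq sums_iff)
  ultimately show ?thesis
    using ptilde_nonneg[OF assms policy_action] by (simp add: pmf_embed_pmf)
qed

lemma ep_eq_hits:
  "ep b f i = measure (ctmc_space (\<lambda>i j. rate b j i (f i))) (hits (\<lambda>i j. rate b j i (f i)) i)"
proof -
  have "hitting_time (\<lambda>i j. rate b j i (f i)) i 0 \<omega> < \<infinity> \<longleftrightarrow> (\<exists>n. jump_chain i \<omega> n = 0)" for \<omega>
    by (rule hitting_time_finite_iff) (rule rate_diag_zero_iff)
  then show ?thesis by (simp only: ep_def Let_def hits_def)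
qed

lemma ennreal_ep:
  "ennreal (ep b f i) =
    emeasure (ctmc_space (\<lambda>i j. rate b j i (f i))) (hits (\<lambda>i j. rate b j i (f i)) i)"
proof -
  interpret prob_space "ctmc_space (\<lambda>i j. rate b j i (f i))" by (rule prob_space_ctmc_space)
  show ?thesis by (simp add: ep_eq_hits emeasure_eq_measure)
qed

lemma ep_bounds: "0 \<le> ep b f i" "ep b f i \<le> 1"
proof -
  interpret prob_space "ctmc_space (\<lambda>i j. rate b j i (f i))" by (rule prob_space_ctmc_space)
  show "0 \<le> ep b f i" "ep b f i \<le> 1" by (simp_all add: ep_eq_hits)
qed

lemma bounded_ep: "bounded (range (ep b f))"
  using ep_bounds by (auto simp: bounded_iff intro!: exI[of _ 1])

lemma ep_zero: "ep b f 0 = 1"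
proof -
  interpret prob_space "ctmc_space (\<lambda>i j. rate b j i (f i))" by (rule prob_space_ctmc_space)
  have "hits (\<lambda>i j. rate b j i (f i)) 0 = space (ctmc_space (\<lambda>i j. rate b j i (f i)))"
    by (auto simp: hits_def intro: exI[of _ 0])
  then show ?thesis by (simp add: ep_eq_hits prob_space)
qed

lemma ep_first_step:
  assumes "0 < i"
  shows "ep b f i = step b i (f i) (ep b f)"
proof -
  have nonneg: "0 \<le> ptilde b j i (f i) * ep b f j" for j
    by (intro mult_nonneg_nonneg ptilde_nonneg[OF assms policy_action] ep_bounds)
  have "ennreal (ep b f i) = (\<Sum>j. ennreal (ptilde b j i (f i)) * ennreal (ep b f j))"
    unfolding ennreal_ep using assms
    by (simp add: emeasure_hits_first_step pmf_jump_policy)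
  also have "\<dots> = (\<Sum>j. ennreal (ptilde b j i (f i) * ep b f j))"
    by (simp add: ennreal_mult' ep_bounds ennreal_mult'')
  also have "\<dots> = ennreal (step b i (f i) (ep b f))"
    unfolding step_def
    by (rule suminf_ennreal2[OF nonneg summable_step[OF assms policy_action bounded_ep]])
  finally show ?thesis
    using nonneg summable_step[OF assms policy_action bounded_ep]
    by (subst (asm) ennreal_inj) (auto simp: ep_bounds step_def intro: suminf_nonneg)
qed

text \<open>
  The source of all upper bounds on extinction probabilities: to bound \<open>ep b f\<close>, exhibit a function
  that the policy does not increase on average.
\<close>

lemma ep_le_supersolution:
  assumes "\<And>j. 0 \<le> x j" "bounded (range x)" "1 \<le> x 0"
    and super: "\<And>i. 0 < i \<Longrightarrow> step b i (f i) x \<le> x i"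
  shows "ep b f i \<le> x i"
proof -
  have "ennreal (ep b f i) \<le> ennreal (x i)"
    unfolding ennreal_ep
  proof (rule emeasure_hits_le_supersolution)
    show "1 \<le> ennreal (x 0)" using assms(3) by simp
    fix i :: nat
    assume "i \<noteq> 0"
    then have i: "0 < i" by simp
    have "(\<Sum>j. ennreal (ptilde b j i (f i)) * ennreal (x j)) =
        (\<Sum>j. ennreal (ptilde b j i (f i) * x j))"
      by (simp add: assms ennreal_mult'')
    also have "\<dots> = ennreal (step b i (f i) x)"
      unfolding step_def
      by (intro suminf_ennreal2 summable_step[OF i policy_action assms(2)] mult_nonneg_nonneg
          ptilde_nonneg[OF i policy_action] assms)
    also have "\<dots> \<le> ennreal (x i)" using super[OF i] by (rule ennreal_leI)
    finally show "(\<Sum>j. ennreal (pmf (jump_pmf (\<lambda>i j. rate b j i (f i)) i) j) * ennreal (x j))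
        \<le> ennreal (x i)"
      by (simp add: pmf_jump_policy[OF i])
  qed
  then show ?thesis using assms(1) by simp
qed

end

section \<open>Generating functions and their smallest roots\<close>

lemma gen_fun_zero: "gen_fun b a 0 = b a 0"
  by (simp add: gen_fun_def powser_zero)

lemma continuous_on_gen_fun:
  assumes "a \<in> A i"
  shows "continuous_on {0..1} (gen_fun b a)"
proof -
  have "summable (\<lambda>k. \<bar>b a (k + 2)\<bar>)"
    using b_summable[OF assms] b_nonneg[OF action_in_Union[OF assms]]
    by (simp add: summable_iff_shift del: add_2_eq_Suc')
  then have summable: "summable (\<lambda>k. \<bar>b a k\<bar>)" by (subst (asm) summable_iff_shift)
  have "uniform_limit {0..1} (\<lambda>n v. \<Sum>k<n. b a k * v ^ k) (\<lambda>v. \<Sum>k. b a k * v ^ k) sequentially"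
    by (rule Weierstrass_m_test[OF _ summable])
      (auto simp: abs_mult power_le_one intro!: mult_left_le)
  then have "uniform_limit {0..1} (\<lambda>n v. \<Sum>k<n. b a k * v ^ k) (gen_fun b a) sequentially"
    by (simp add: gen_fun_def[abs_def])
  then show ?thesis
    by (rule uniform_limit_theorem[rotated]) (auto intro!: always_eventually continuous_intros)
qed

lemma rho_is_least_root:
  assumes "a \<in> A i"
  shows "0 \<le> \<rho> b a" "\<rho> b a \<le> 1" "gen_fun b a (\<rho> b a) = 0"
    and "\<And>v. 0 \<le> v \<Longrightarrow> v \<le> 1 \<Longrightarrow> gen_fun b a v = 0 \<Longrightarrow> \<rho> b a \<le> v"
proof -
  define Z where "Z = {v \<in> {0..1}. gen_fun b a v = 0}"
  have "closed Z"
    unfolding Z_def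
    by (intro continuous_closed_preimage_constant continuous_on_gen_fun[OF assms]) simp
  moreover have "bounded Z"
    by (rule bounded_subset[of "{0..1}"]) (auto simp: Z_def)
  moreover have "1 \<in> Z" using gen_fun_one[OF assms] by (simp add: Z_def)
  ultimately obtain v where v: "v \<in> Z" "\<And>w. w \<in> Z \<Longrightarrow> v \<le> w"
    using compact_attains_inf[of Z] by (auto simp: compact_eq_bounded_closed)
  have "\<rho> b a = v"
    unfolding \<rho>_def by (rule Least_equality) (use v in \<open>auto simp: Z_def\<close>)
  then show "0 \<le> \<rho> b a" "\<rho> b a \<le> 1" "gen_fun b a (\<rho> b a) = 0"
    and "\<And>v. 0 \<le> v \<Longrightarrow> v \<le> 1 \<Longrightarrow> gen_fun b a v = 0 \<Longrightarrow> \<rho> b a \<le> v"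
    using v by (auto simp: Z_def)
qed

text \<open>
  The generating function starts at \<open>b a 0 \<ge> 0\<close>; a negative value would force an earlier root.
\<close>

lemma gen_fun_nonneg_below_rho:
  assumes "a \<in> A i" "0 \<le> s" "s \<le> \<rho> b a"
  shows "0 \<le> gen_fun b a s"
proof (rule ccontr)
  assume neg: "\<not> 0 \<le> gen_fun b a s"
  have "s \<le> 1" using rho_is_least_root(2)[OF assms(1)] assms by linarith
  then have "\<exists>v\<ge>0. v \<le> s \<and> gen_fun b a v = 0"
    using neg assms(2) b_zero_nonneg[OF assms(1)]
    by (intro IVT2' continuous_on_subset[OF continuous_on_gen_fun[OF assms(1)]])
      (auto simp: gen_fun_zero)
  then obtain v where v: "0 \<le> v" "v \<le> s" "gen_fun b a v = 0" by blast
  then have "\<rho> b a \<le> v" using \<open>s \<le> 1\<close> by (intro rho_is_least_root(4)[OF assms(1)]) auto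
  then have "s = v" using v assms(3) by linarith
  then show False using v neg by simp
qed

lemma Abar_eq: "Abar = A m"
  using actions_const[of m] by simp

lemma rho_min_le: "a \<in> Abar \<Longrightarrow> rho_min b Abar \<le> \<rho> b a"
  unfolding rho_min_def using actions[of m] by (intro Min_le) (auto simp: Abar_eq)

lemma rho_min_bounds: "0 \<le> rho_min b Abar" "rho_min b Abar \<le> 1"
proof -
  have "rho_min b Abar \<in> \<rho> b ` Abar"
    unfolding rho_min_def using actions[of m] by (intro Min_in) (auto simp: Abar_eq)
  then show "0 \<le> rho_min b Abar" "rho_min b Abar \<le> 1"
    using rho_is_least_root(1,2)[of _ m] by (auto simp: Abar_eq)
qed

section \<open>Minimum principles\<close>

text \<open>
  The condition on \<open>b a 0\<close> makes the predecessor of each state beyond \<open>k\<close> reachable in one jump; without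
  it a minimum could not be carried down to the boundary.
\<close>

definition superharmonic_beyond :: "nat \<Rightarrow> (nat \<Rightarrow> real) \<Rightarrow> bool" where
  "superharmonic_beyond k d \<longleftrightarrow> (\<forall>i>k. \<exists>a\<in>A i. 0 < b a 0 \<and> step b i a d \<le> d i)"

text \<open>
  At a minimum, the one-step mean can be at most the value itself only if every successor state has
  that same value, and \<open>i - 1\<close> is a successor of \<open>i\<close>.
\<close>

lemma minimum_propagates_down:
  assumes "bounded (range d)" and min: "\<And>j. d i0 \<le> d j" and "k \<le> i0"
    and super: "\<And>i. k < i \<Longrightarrow> i \<le> i0 \<Longrightarrow> \<exists>a\<in>A i. 0 < b a 0 \<and> step b i a d \<le> d i"
  shows "d k = d i0"
  using \<open>k \<le> i0\<close>
proof (induction rule: inc_induct)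
  case base
  then show ?case by simp
next
  case (step n)
  obtain a where a: "a \<in> A (Suc n)" "0 < b a 0" "step b (Suc n) a d \<le> d (Suc n)"
    using super[of "Suc n"] step.hyps by auto
  define e where "e j = d j - d i0" for j
  have e: "0 \<le> e j" for j by (simp add: e_def min)
  have bounded_e: "bounded (range e)"
    unfolding e_def by (intro bounded_minus_comp assms(1)) simp
  have "step b (Suc n) a e = step b (Suc n) a d - d i0"
    unfolding e_def using a(1) by (subst step_diff) (auto simp: assms(1) step_const)
  then have "step b (Suc n) a e \<le> 0" using a(3) step.IH by simp
  moreover have "ptilde b n (Suc n) a * e n \<le> step b (Suc n) a e"
    unfolding step_def
    using sum_le_suminf[OF summable_step[OF _ a(1) bounded_e], of "{n}"] a(1)
    by (simp add: e ptilde_nonneg)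
  moreover have "0 < ptilde b n (Suc n) a"
    using ptilde_pred_pos[of "Suc n" a] a by simp
  ultimately have "e n \<le> 0" by (smt (verit) mult_pos_pos)
  then show ?case using min[of n] by (simp add: e_def)
qed

text \<open>
  A negative value lies below all but finitely many others, so that a global minimum is attained,
  beyond the boundary.
\<close>

lemma minimum_principle_vanishing:
  assumes "bounded (range d)" and super: "superharmonic_beyond k d"
    and boundary: "\<And>j. j \<le> k \<Longrightarrow> 0 \<le> d j"
    and vanishing: "\<And>e. 0 < e \<Longrightarrow> \<forall>\<^sub>F j in sequentially. - e \<le> d j"
  shows "0 \<le> d i"
proof (rule ccontr)
  assume neg: "\<not> 0 \<le> d i"
  then obtain N where N: "\<And>j. N \<le> j \<Longrightarrow> d i \<le> d j"
    using vanishing[of "- d i"] by (auto simp: eventually_sequentially)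
  obtain i0 where i0: "i0 \<le> max N i" "\<And>j. j \<le> max N i \<Longrightarrow> d i0 \<le> d j"
    using ex_is_arg_min_if_finite[of "{..max N i}" d] by (auto simp: is_arg_min_linorder)
  have min: "d i0 \<le> d j" for j
    using i0(2)[of j] i0(2)[of i] N[of j] by (cases "N \<le> j") auto
  have "d i0 < 0" using min[of i] neg by simp
  then have "k < i0" using boundary[of i0] by (meson leI not_less)
  then have "d k = d i0"
    using super
    by (intro minimum_propagates_down assms(1) min) (auto simp: superharmonic_beyond_def)
  then show False using \<open>d i0 < 0\<close> boundary[of k] by simp
qed

text \<open>
  The lower bound has the shape that differences of extinction probabilities with geometric tails
  have. In the critical case \<open>r = 1\<close> it says no more than boundedness, and the barrier
  \<open>(C + 1) * (1 - s ^ j)\<close> replaces the missing decay: it is superharmonic beyond \<open>m\<close>, since all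
  actions there have generating functions that are nonnegative on the unit interval.
\<close>

lemma minimum_principle_geometric:
  assumes "bounded (range d)" and super: "superharmonic_beyond k d" and "m \<le> k"
    and boundary: "\<And>j. j \<le> k \<Longrightarrow> 0 \<le> d j"
    and "0 \<le> C" and lower: "\<And>j. - C * rho_min b Abar ^ j \<le> d j"
  shows "0 \<le> d i"
proof (cases "rho_min b Abar < 1")
  case True
  have "(\<lambda>j. C * rho_min b Abar ^ j) \<longlonglongrightarrow> C * 0"
    using True rho_min_bounds by (intro tendsto_mult_left LIMSEQ_power_zero) auto
  then have "\<forall>\<^sub>F j in sequentially. C * rho_min b Abar ^ j < e" if "0 < e" for e
    using that by (intro order_tendstoD(2)) auto
  then have "\<forall>\<^sub>F j in sequentially. - e \<le> d j" if "0 < e" for e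
  proof (rule eventually_mono)
    show "- e \<le> d j" if "C * rho_min b Abar ^ j < e" for j
      using that lower[of j] by simp
  qed (fact that)
  then show ?thesis
    using minimum_principle_vanishing[OF assms(1) super boundary] by blast
next
  case False
  then have rho_one: "rho_min b Abar = 1" using rho_min_bounds by simp
  have bound: "- (C + 1) * (1 - s ^ i) \<le> d i" if s: "0 < s" "s < 1" for s
  proof -
    \<comment> \<open>The factor \<open>C + 1\<close> exceeds the bound \<open>C\<close>, so that \<open>w\<close> is positive near infinity.\<close>
    define w where "w j = d j + (C + 1) * (1 - s ^ j)" for j
    have s_power: "0 \<le> s ^ j" "s ^ j \<le> 1" for j using s by (auto intro: power_le_one)
    then have bounded_s: "bounded (range (\<lambda>j. s ^ j))"
      by (auto simp: bounded_iff intro!: exI[of _ 1])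
    then have bounded_V: "bounded (range (\<lambda>j. 1 - s ^ j))"
      by (intro bounded_minus_comp) auto
    have bounded_CV: "bounded (range (\<lambda>j. (C + 1) * (1 - s ^ j)))"
      using bounded_scaleR_comp[OF bounded_V, of "C + 1"] by simp
    have "0 \<le> w i"
    proof (rule minimum_principle_vanishing)
      show "bounded (range w)"
        unfolding w_def by (intro bounded_plus_comp assms(1) bounded_CV)
      show "superharmonic_beyond k w"
        unfolding superharmonic_beyond_def
      proof (intro allI impI)
        fix i assume "k < i"
        then obtain a where a: "a \<in> A i" "0 < b a 0" "step b i a d \<le> d i"
          using super by (auto simp: superharmonic_beyond_def)
        have i: "0 < i" using \<open>k < i\<close> by simp
        have "a \<in> Abar" using a(1) actions_const[of i] \<open>m \<le> k\<close> \<open>k < i\<close> by simp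
        then have "0 \<le> gen_fun b a s"
          using gen_fun_nonneg_below_rho[OF a(1)] rho_min_le[of a] rho_one s by auto
        then have "0 \<le> s ^ (i - 1) * gen_fun b a s / (- b a 1)"
          using s_power b_one_neg[OF a(1)] by (intro divide_nonneg_pos mult_nonneg_nonneg) auto
        then have "s ^ i \<le> step b i a (\<lambda>j. s ^ j)"
          using step_power[OF i a(1)] s by simp
        moreover have "step b i a w =
            step b i a d + (C + 1) * (1 - step b i a (\<lambda>j. s ^ j))"
          unfolding w_def
          by (simp add: step_add[OF i a(1) assms(1) bounded_CV] step_cmult[OF i a(1) bounded_V]
              step_diff[OF i a(1) _ bounded_s] step_const[OF i a(1)])
        ultimately have "step b i a w \<le> w i"
          unfolding w_def using a(3) \<open>0 \<le> C\<close> by (intro order.trans[OF eq_refl add_mono]) auto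
        then show "\<exists>a\<in>A i. 0 < b a 0 \<and> step b i a w \<le> w i" using a by blast
      qed
      show "0 \<le> w j" if "j \<le> k" for j
        unfolding w_def using boundary[OF that] \<open>0 \<le> C\<close> s_power[of j] by simp
      have "(\<lambda>j. (C + 1) * s ^ j) \<longlonglongrightarrow> (C + 1) * 0"
        using s by (intro tendsto_mult_left LIMSEQ_power_zero) auto
      then have ev: "\<forall>\<^sub>F j in sequentially. (C + 1) * s ^ j < 1"
        by (intro order_tendstoD(2)) auto
      show "\<forall>\<^sub>F j in sequentially. - e \<le> w j" if "0 < e" for e
        using ev
      proof (rule eventually_mono)
        fix j assume "(C + 1) * s ^ j < 1"
        then show "- e \<le> w j"
          using lower[of j] that unfolding w_def rho_one by (simp add: algebra_simps)
      qed
    qed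
    then show ?thesis unfolding w_def by (simp add: algebra_simps)
  qed
  have "((\<lambda>s. - (C + 1) * (1 - s ^ i)) \<longlongrightarrow> - (C + 1) * (1 - 1 ^ i)) (at_left 1)"
    by (intro tendsto_intros)
  moreover have "\<forall>\<^sub>F s in at_left 1. - (C + 1) * (1 - s ^ i) \<le> d i"
    using bound unfolding eventually_at_left_field by (intro exI[of _ 0]) auto
  ultimately have "- (C + 1) * (1 - 1 ^ i) \<le> d i"
    by (rule tendsto_upperbound) simp
  then show ?thesis by simp
qed

section \<open>Geometric tails\<close>

lemma bounded_cmult_power:
  fixes c s :: real
  assumes "0 \<le> s" "s \<le> 1"
  shows "bounded (range (\<lambda>j. c * s ^ j))"
proof (rule boundedI[of _ "\<bar>c\<bar>"])
  show "norm x \<le> \<bar>c\<bar>" if "x \<in> range (\<lambda>j. c * s ^ j)" for x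
    using that assms by (auto simp: abs_mult power_le_one intro!: mult_left_le)
qed

lemma bounded_power: "0 \<le> s \<Longrightarrow> s \<le> 1 \<Longrightarrow> bounded (range (\<lambda>j. s ^ j :: real))"
  using bounded_cmult_power[of s 1] by simp

text \<open>
  Beyond \<open>m\<close> the population evolves as an uncontrolled branching process, which ever descends by one
  level with probability \<open>r\<close>, independently for each of the \<open>i - m\<close> levels down to \<open>m\<close>. Analytically:
  the candidate \<open>c * r ^ j\<close> is harmonic beyond \<open>m\<close> and agrees with \<open>ep b f\<close> at \<open>m\<close>; it is an upper
  bound because cutting \<open>ep b f\<close> off at the candidate leaves a supersolution, and a lower bound by the
  minimum principle.
\<close>

lemma ep_geometric_tail:
  assumes f: "f \<in> policies A" and tail: "\<And>i. m < i \<Longrightarrow> f i = a"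
    and a: "a \<in> Abar" "\<rho> b a = rho_min b Abar" "0 < b a 0" and "m \<le> i"
  shows "ep b f i = rho_min b Abar ^ (i - m) * ep b f m"
proof -
  define r where "r = rho_min b Abar"
  define u where "u = ep b f"
  define c where "c = u m / r ^ m"
  have root: "gen_fun b a r = 0" and r: "0 \<le> r" "r \<le> 1"
    using rho_is_least_root[of a m] a rho_min_bounds by (auto simp: Abar_eq r_def)
  have "r \<noteq> 0" using root a(3) by (auto simp: gen_fun_zero)
  then have "0 < r" using r by simp
  have u_m: "u m = c * r ^ m" using \<open>0 < r\<close> by (simp add: c_def)
  have u: "0 \<le> u j" "u j \<le> 1" for j using ep_bounds[OF f] by (auto simp: u_def)
  have "0 \<le> c" using u[of m] r by (simp add: c_def)
  have bounded_u: "bounded (range u)" using bounded_ep[OF f] by (simp add: u_def)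
  note bounded_c = bounded_cmult_power[OF r, of c]
  have action: "a \<in> A j" if "m < j" for j using actions_const[of j] that a by simp
  have first_step: "step b j (f j) u = u j" if "0 < j" for j
    using ep_first_step[OF f that] by (simp add: u_def)
  have harmonic: "step b j a (\<lambda>l. c * r ^ l) = c * r ^ j" if "m < j" for j
    using that step_cmult[OF _ action bounded_power[OF r], of j c]
      step_power[OF _ action r, of j] by (simp add: root)
  have "u i \<le> c * r ^ i"
  proof -
    define x where "x j = (if j \<le> m then u j else min (u j) (c * r ^ j))" for j
    have x_le_u: "x j \<le> u j" for j by (simp add: x_def)
    have x_le_c: "x j \<le> c * r ^ j" if "m \<le> j" for j
      using that u_m by (cases "j = m") (auto simp: x_def)
    have x_nonneg: "0 \<le> x j" for j using u \<open>0 \<le> c\<close> r by (simp add: x_def)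
    have bounded_x: "bounded (range x)"
      by (rule boundedI[of _ 1]) (use x_nonneg order_trans[OF x_le_u u(2)] in auto)
    have "ep b f i \<le> x i"
    proof (rule ep_le_supersolution[OF f x_nonneg bounded_x])
      show "1 \<le> x 0" by (simp add: x_def u_def ep_zero[OF f])
      fix j :: nat assume j: "0 < j"
      have le_u: "step b j (f j) x \<le> u j"
        using step_mono[OF j policy_action[OF f] bounded_x bounded_u x_le_u] first_step[OF j]
        by simp
      show "step b j (f j) x \<le> x j"
      proof (cases "j \<le> m")
        case True
        then show ?thesis using le_u by (simp add: x_def)
      next
        case False
        then have "step b j (f j) x \<le> step b j (f j) (\<lambda>l. c * r ^ l)"
          by (intro step_mono j policy_action[OF f] bounded_x bounded_c x_le_c) simp
        then have "step b j (f j) x \<le> c * r ^ j" using False harmonic[of j] tail[of j] by simp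
        then show ?thesis using False le_u by (simp add: x_def)
      qed
    qed
    also have "x i \<le> c * r ^ i" by (rule x_le_c) fact
    finally show ?thesis by (simp add: u_def)
  qed
  moreover have "c * r ^ i \<le> u i"
  proof -
    define d where "d j = (if j < m then 0 else u j - c * r ^ j)" for j
    have bounded_diff: "bounded (range (\<lambda>j. u j - c * r ^ j))"
      by (intro bounded_minus_comp bounded_u bounded_c)
    have "0 \<le> d i"
    proof (rule minimum_principle_geometric[of d m c])
      show "bounded (range d)"
        by (rule bounded_subset[OF bounded_insert[THEN iffD2, OF bounded_diff, of 0]])
          (auto simp: d_def)
      show "superharmonic_beyond m d"
        unfolding superharmonic_beyond_def
      proof (intro allI impI bexI conjI)
        fix j assume j: "m < j"
        have "step b j a d = step b j a (\<lambda>l. u l - c * r ^ l)"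
          using j by (intro step_cong) (simp add: d_def)
        also have "\<dots> = u j - c * r ^ j"
          using j step_diff[OF _ action bounded_u bounded_c, of j] harmonic[OF j]
            first_step[of j] tail[OF j] by simp
        finally show "step b j a d \<le> d j" using j by (simp add: d_def)
      qed (use a action in auto)
      show "0 \<le> d j" if "j \<le> m" for j using that u_m by (cases "j = m") (auto simp: d_def)
      show "- c * rho_min b Abar ^ j \<le> d j" for j
        using u[of j] \<open>0 \<le> c\<close> r by (simp add: d_def r_def[symmetric])
    qed (use \<open>0 \<le> c\<close> in auto)
    then show ?thesis using \<open>m \<le> i\<close> by (simp add: d_def)
  qed
  ultimately have "u i = c * r ^ i" by simp
  moreover have "r ^ i = r ^ (i - m) * r ^ m"
    using \<open>m \<le> i\<close> by (simp add: power_add[symmetric])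
  ultimately show ?thesis using u_m by (simp add: u_def r_def)
qed

section \<open>The optimality equation\<close>

lemma ep_min_le: "g \<in> policies A \<Longrightarrow> ep_min A b i \<le> ep b g i"
  unfolding ep_min_def by (rule cINF_lower) (auto intro!: bdd_belowI[of _ 0] ep_bounds)

lemma optimal_iff:
  assumes f: "f \<in> policies A"
  shows "optimal A b f \<longleftrightarrow> (\<forall>g\<in>policies A. \<forall>i\<ge>1. ep b f i \<le> ep b g i)"
proof
  assume "optimal A b f"
  then show "\<forall>g\<in>policies A. \<forall>i\<ge>1. ep b f i \<le> ep b g i"
    using ep_min_le by (auto simp: optimal_def)
next
  assume le: "\<forall>g\<in>policies A. \<forall>i\<ge>1. ep b f i \<le> ep b g i"
  show "optimal A b f"
    unfolding optimal_def
  proof (intro allI impI antisym)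
    fix i :: nat assume "1 \<le> i"
    then show "ep b f i \<le> ep_min A b i"
      unfolding ep_min_def using le f by (intro cINF_greatest) auto
  qed (rule ep_min_le[OF f])
qed

text \<open>
  Policy improvement: changing \<open>f\<close> to a better action at the single state \<open>i\<close> keeps \<open>ep b f\<close> a
  supersolution, so the changed policy is nowhere worse, and at \<open>i\<close> it is strictly better.
\<close>

lemma optimal_imp_optimality_equation:
  assumes f: "f \<in> policies A" and opt: "optimal A b f" and i: "0 < i"
  shows "ep b f i = Min ((\<lambda>a. step b i a (ep b f)) ` A i)"
proof (rule Min_eqI[symmetric])
  show "finite ((\<lambda>a. step b i a (ep b f)) ` A i)" using actions[of i] by simp
  show "ep b f i \<in> (\<lambda>a. step b i a (ep b f)) ` A i"
    using ep_first_step[OF f i] policy_action[OF f] by blast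
  fix y assume "y \<in> (\<lambda>a. step b i a (ep b f)) ` A i"
  then obtain a where a: "a \<in> A i" and y: "y = step b i a (ep b f)" by blast
  show "ep b f i \<le> y"
  proof (rule ccontr)
    assume less: "\<not> ep b f i \<le> y"
    define g where "g = f(i := a)"
    have g: "g \<in> policies A" using f a by (simp add: g_def policies_def)
    have le: "ep b g j \<le> ep b f j" for j
    proof (rule ep_le_supersolution[OF g])
      fix j :: nat assume "0 < j"
      then show "step b j (g j) (ep b f) \<le> ep b f j"
        using less y ep_first_step[OF f, of j] by (cases "j = i") (auto simp: g_def)
    qed (auto simp: ep_bounds[OF f] bounded_ep[OF f] ep_zero[OF f])
    have "ep b g i = step b i a (ep b g)"
      using ep_first_step[OF g i] by (simp add: g_def)
    also have "\<dots> \<le> step b i a (ep b f)"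
      by (intro step_mono i a bounded_ep f g le)
    also have "\<dots> < ep b f i" using less y by simp
    finally have "ep b g i < ep b f i" .
    moreover have "ep b f i \<le> ep b g i" using opt g i unfolding optimal_iff[OF f] by simp
    ultimately show False by simp
  qed
qed

text \<open>
  A vector on \<open>{1..n}\<close> becomes a function on all states by the absorbing value \<open>1\<close> at \<open>0\<close> and a tail
  proportional to its last entry. The tails \<open>t j = r ^ (j - m)\<close> with \<open>n = m\<close>, and \<open>t j = 0\<close> with
  \<open>n = m_star A b m - 1\<close>, turn the two finite systems into the optimality equation on \<open>{1..n}\<close>.
\<close>

definition extend :: "nat \<Rightarrow> (nat \<Rightarrow> real) \<Rightarrow> (nat \<Rightarrow> real) \<Rightarrow> nat \<Rightarrow> real" where
  "extend n t x j = (if j = 0 then 1 else if j \<le> n then x j else t j * x n)"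

definition solves :: "nat \<Rightarrow> (nat \<Rightarrow> real) \<Rightarrow> (nat \<Rightarrow> real) \<Rightarrow> bool" where
  "solves n t x \<longleftrightarrow>
    (\<forall>i\<in>{1..n}. x i = Min ((\<lambda>a. step b i a (extend n t x)) ` A i)) \<and>
    (\<forall>i\<in>{1..n}. 0 \<le> x i \<and> x i \<le> 1)"

lemma bounded_extend:
  assumes "\<And>j. 0 \<le> t j" "\<And>j. t j \<le> 1"
  shows "bounded (range (extend n t x))"
proof -
  have "range (extend n t x) \<subseteq> insert 1 (x ` {..n}) \<union> (\<lambda>s. s * x n) ` {0..1}"
  proof (rule image_subsetI)
    show "extend n t x j \<in> insert 1 (x ` {..n}) \<union> (\<lambda>s. s * x n) ` {0..1}" for j
      using assms[of j] by (auto simp: extend_def)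
  qed
  moreover have "bounded ((\<lambda>s. s * x n) ` {0..1})"
    by (intro compact_imp_bounded compact_continuous_image continuous_intros) simp
  then have "bounded (insert 1 (x ` {..n}) \<union> (\<lambda>s. s * x n) ` {0..1})"
    by (simp add: bounded_Un finite_imp_bounded)
  ultimately show ?thesis by (rule bounded_subset[rotated])
qed

text \<open>
  The difference \<open>d\<close> of two extended solutions is superharmonic under the minimising actions of \<open>x\<close>,
  and because \<open>0 \<le> t j \<le> 1\<close> its minimum over \<open>{..n}\<close> is a global one. It propagates down to \<open>0\<close>, where
  \<open>d\<close> vanishes.
\<close>

lemma solution_le_solution:
  assumes x: "solves n t x" and y: "solves n t y"
    and t: "\<And>j. 0 \<le> t j" "\<And>j. t j \<le> 1"
    and positive: "\<And>i a. i \<in> {1..n} \<Longrightarrow> a \<in> A i \<Longrightarrow> 0 < b a 0"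
    and i: "i \<in> {1..n}"
  shows "y i \<le> x i"
proof -
  define d where "d j = extend n t x j - extend n t y j" for j
  have bounded_d: "bounded (range d)"
    unfolding d_def by (intro bounded_minus_comp bounded_extend t)
  obtain i0 where i0: "i0 \<le> n" "\<And>j. j \<le> n \<Longrightarrow> d i0 \<le> d j"
    using ex_is_arg_min_if_finite[of "{..n}" d] by (auto simp: is_arg_min_linorder)
  have d_zero: "d 0 = 0" by (simp add: d_def extend_def)
  then have "d i0 \<le> 0" using i0(2)[of 0] by simp
  have min: "d i0 \<le> d j" for j
  proof (cases "j \<le> n")
    case False
    then have "d j = t j * d n"
      using i by (auto simp: d_def extend_def right_diff_distrib)
    moreover have "t j * d i0 \<le> t j * d n" using t i0 by (intro mult_left_mono) auto
    moreover have "1 * d i0 \<le> t j * d i0" using t \<open>d i0 \<le> 0\<close> by (intro mult_right_mono_neg) auto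
    ultimately show ?thesis by simp
  qed (rule i0)
  have "d 0 = d i0"
  proof (rule minimum_propagates_down[OF bounded_d min])
    fix j assume "0 < j" "j \<le> i0"
    then have j: "j \<in> {1..n}" using i0 by simp
    have "x j \<in> (\<lambda>a. step b j a (extend n t x)) ` A j"
      using x j actions[of j] Min_in[of "(\<lambda>a. step b j a (extend n t x)) ` A j"]
      by (simp add: solves_def)
    then obtain a where a: "a \<in> A j" "x j = step b j a (extend n t x)" by blast
    moreover have "y j \<le> step b j a (extend n t y)"
      using y j a(1) actions[of j] by (simp add: solves_def)
    moreover have "step b j a d = step b j a (extend n t x) - step b j a (extend n t y)"
      unfolding d_def by (intro step_diff \<open>0 < j\<close> a bounded_extend t)
    ultimately have "step b j a d \<le> d j" using j by (simp add: d_def extend_def)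
    then show "\<exists>a\<in>A j. 0 < b a 0 \<and> step b j a d \<le> d j" using a positive[OF j] by blast
  qed simp
  then show ?thesis using min[of i] d_zero i by (simp add: d_def extend_def)
qed

lemma unique_solution_iff:
  assumes "\<And>j. 0 \<le> t j" "\<And>j. t j \<le> 1"
    and "\<And>i a. i \<in> {1..n} \<Longrightarrow> a \<in> A i \<Longrightarrow> 0 < b a 0"
  shows "unique_solution_on {1..n} (solves n t) x \<longleftrightarrow> solves n t x"
  unfolding unique_solution_on_def
proof (intro iffI conjI allI impI ballI; (elim conjE)?)
  fix y i assume "solves n t x" "solves n t y" "i \<in> {1..n}"
  then show "y i = x i"
    by (intro antisym solution_le_solution[OF _ _ assms])
qed

lemma optimal_imp_solves:
  assumes f: "f \<in> policies A" and opt: "optimal A b f" and "extend n t (ep b f) = ep b f"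
  shows "solves n t (ep b f)"
  unfolding solves_def assms(3)
  by (intro conjI ballI optimal_imp_optimality_equation[OF f opt] ep_bounds[OF f]) simp

lemma solves_imp_le_step:
  assumes "solves n t x" "extend n t x = x" "i \<in> {1..n}" "a \<in> A i"
  shows "x i \<le> step b i a x"
  using assms actions[of i] by (simp add: solves_def)

lemma superharmonic_at_ep_diff:
  assumes f: "f \<in> policies A" and g: "g \<in> policies A" and i: "0 < i"
    and sub: "ep b f i \<le> step b i (g i) (ep b f)" and "0 < b (g i) 0"
  shows "\<exists>a\<in>A i. 0 < b a 0 \<and>
           step b i a (\<lambda>j. ep b g j - ep b f j) \<le> ep b g i - ep b f i"
  using assms ep_first_step[OF g i] policy_action[OF g, of i]
    step_diff[OF i policy_action[OF g] bounded_ep[OF g] bounded_ep[OF f]]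
  by (intro bexI[of _ "g i"]) auto

section \<open>The finite systems\<close>

lemma step_extend_geometric:
  assumes i: "0 < i" and a: "a \<in> A i" and r: "0 \<le> r" "r \<le> 1"
  shows "step b i a (extend m (\<lambda>j. r ^ (j - m)) x) =
    ptilde b 0 i a + (\<Sum>j=1..m - 1. ptilde b j i a * x j) + Lsum b m r i a * x m"
proof -
  define y where "y = extend m (\<lambda>j. r ^ (j - m)) x"
  have "summable (\<lambda>j. ptilde b j i a * y j)"
    unfolding y_def using r
    by (intro summable_step i a bounded_extend) (auto intro: power_le_one)
  then have "step b i a y = (\<Sum>k. ptilde b (k + m) i a * y (k + m)) + (\<Sum>j<m. ptilde b j i a * y j)"
    unfolding step_def by (rule suminf_split_initial_segment)
  also have "(\<Sum>k. ptilde b (k + m) i a * y (k + m)) =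
      (\<Sum>k. ptilde b (m + k) i a * r ^ k * x m)"
    using m_pos by (intro suminf_cong) (auto simp: y_def extend_def add.commute)
  also have "\<dots> = Lsum b m r i a * x m"
    unfolding Lsum_def
  proof (rule suminf_mult2[symmetric])
    have "bounded (range (\<lambda>j. r ^ (j - m)))"
      using r by (intro boundedI[of _ 1]) (auto intro: power_le_one)
    then have "summable (\<lambda>j. ptilde b j i a * r ^ (j - m))"
      by (intro summable_step i a)
    then have "summable (\<lambda>k. ptilde b (k + m) i a * r ^ (k + m - m))"
      by (rule summable_ignore_initial_segment)
    then show "summable (\<lambda>k. ptilde b (m + k) i a * r ^ k)" by (simp add: add.commute)
  qed
  also have "(\<Sum>j<m. ptilde b j i a * y j) = ptilde b 0 i a + (\<Sum>j=1..m - 1. ptilde b j i a * x j)"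
  proof -
    have "{..<m} = insert 0 {1..m - 1}" using m_pos by auto
    then have "(\<Sum>j<m. ptilde b j i a * y j) =
        ptilde b 0 i a * y 0 + (\<Sum>j=1..m - 1. ptilde b j i a * y j)" by simp
    also have "(\<Sum>j=1..m - 1. ptilde b j i a * y j) = (\<Sum>j=1..m - 1. ptilde b j i a * x j)"
      by (intro sum.cong) (auto simp: y_def extend_def)
    finally show ?thesis by (simp add: y_def extend_def)
  qed
  finally show ?thesis by (simp add: y_def)
qed

lemma step_extend_null:
  "step b i a (extend n (\<lambda>j. 0) x) = ptilde b 0 i a + (\<Sum>j=1..n. ptilde b j i a * x j)"
proof -
  have "step b i a (extend n (\<lambda>j. 0) x) = (\<Sum>j\<in>insert 0 {1..n}. ptilde b j i a * extend n (\<lambda>j. 0) x j)"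
    unfolding step_def by (rule suminf_finite) (auto simp: extend_def)
  also have "\<dots> = ptilde b 0 i a + (\<Sum>j=1..n. ptilde b j i a * extend n (\<lambda>j. 0) x j)"
    by (simp add: extend_def)
  also have "(\<Sum>j=1..n. ptilde b j i a * extend n (\<lambda>j. 0) x j) = (\<Sum>j=1..n. ptilde b j i a * x j)"
    by (intro sum.cong) (auto simp: extend_def)
  finally show ?thesis .
qed

section \<open>Solutions are optimal\<close>

text \<open>
  Verification. The tail of \<open>ep b f\<close> is subharmonic under every action beyond \<open>m\<close>, because the least
  root lies at or below all others; with the hypothesis on \<open>{1..m}\<close>, the difference \<open>d\<close> to any other
  policy is superharmonic at all positive states. The minimum principle is used twice: beyond \<open>m\<close> it shows
  that the minimum of \<open>d\<close> over \<open>{..m}\<close> is a global one, and this minimum then propagates down to \<open>0\<close>.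
\<close>

lemma solution_with_geometric_tail_optimal:
  assumes f: "f \<in> policies A"
    and positive: "\<And>i a. 0 < i \<Longrightarrow> a \<in> A i \<Longrightarrow> 0 < b a 0"
    and "0 < rho_min b Abar"
    and tail: "\<And>i. m \<le> i \<Longrightarrow> ep b f i = rho_min b Abar ^ (i - m) * ep b f m"
    and le_step: "\<And>i a. i \<in> {1..m} \<Longrightarrow> a \<in> A i \<Longrightarrow> ep b f i \<le> step b i a (ep b f)"
  shows "optimal A b f"
proof -
  define r where "r = rho_min b Abar"
  define u where "u = ep b f"
  define c where "c = u m / r ^ m"
  have r: "0 < r" "r \<le> 1" using assms(3) rho_min_bounds by (auto simp: r_def)
  have "0 \<le> c" using ep_bounds[OF f] r by (simp add: c_def u_def)
  have u_geometric: "u j = c * r ^ j" if "m \<le> j" for j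
    using tail[OF that] that r by (simp add: u_def[symmetric] r_def[symmetric] c_def power_diff)
  have subharmonic: "u i \<le> step b i a u" if i: "0 < i" and a: "a \<in> A i" for i a
  proof (cases "i \<le> m")
    case True
    then show ?thesis using le_step[of i a] i a by (simp add: u_def)
  next
    case False
    have "a \<in> Abar" using a actions_const[of i] False by simp
    then have "0 \<le> gen_fun b a r"
      using gen_fun_nonneg_below_rho[OF a] rho_min_le r by (simp add: r_def)
    then have "0 \<le> r ^ (i - 1) * gen_fun b a r / (- b a 1)"
      using r b_one_neg[OF a] by (intro divide_nonneg_pos mult_nonneg_nonneg) auto
    then have "r ^ i \<le> step b i a (\<lambda>j. r ^ j)"
      using step_power[OF i a] r by simp
    then have "c * r ^ i \<le> c * step b i a (\<lambda>j. r ^ j)"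
      using \<open>0 \<le> c\<close> by (rule mult_left_mono)
    also have "\<dots> = step b i a (\<lambda>j. c * r ^ j)"
      using r by (intro step_cmult[symmetric] i a bounded_power) auto
    also have "\<dots> = step b i a u"
      using False by (intro step_cong) (simp add: u_geometric)
    finally show ?thesis using False by (simp add: u_geometric)
  qed
  have "u i \<le> ep b g i" if g: "g \<in> policies A" for g i
  proof -
    define d where "d j = ep b g j - ep b f j" for j
    have bounded_d: "bounded (range d)"
      unfolding d_def by (intro bounded_minus_comp bounded_ep f g)
    have d_zero: "d 0 = 0" by (simp add: d_def ep_zero f g)
    have super: "\<exists>a\<in>A i. 0 < b a 0 \<and> step b i a d \<le> d i" if i: "0 < i" for i
      unfolding d_def using policy_action[OF g, of i] subharmonic[OF i] positive[OF i]
      by (intro superharmonic_at_ep_diff f g i) (auto simp: u_def)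
    obtain i0 where i0: "i0 \<le> m" "\<And>j. j \<le> m \<Longrightarrow> d i0 \<le> d j"
      using ex_is_arg_min_if_finite[of "{..m}" d] by (auto simp: is_arg_min_linorder)
    have "d i0 \<le> 0" using i0(2)[of 0] d_zero by simp
    have min: "d i0 \<le> d j" for j
    proof -
      have "0 \<le> d j - d i0"
      proof (rule minimum_principle_geometric[of "\<lambda>j. d j - d i0" m c])
        show "bounded (range (\<lambda>j. d j - d i0))"
          by (intro bounded_minus_comp bounded_d) simp
        show "superharmonic_beyond m (\<lambda>j. d j - d i0)"
          unfolding superharmonic_beyond_def
        proof (intro allI impI)
          fix i assume "m < i"
          then have i: "0 < i" by simp
          obtain a where a: "a \<in> A i" "0 < b a 0" "step b i a d \<le> d i"
            using super[OF i] by blast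
          have "step b i a (\<lambda>j. d j - d i0) = step b i a d - d i0"
            using step_diff[OF i a(1) bounded_d, of "\<lambda>j. d i0"] by (simp add: step_const[OF i a(1)])
          then show "\<exists>a\<in>A i. 0 < b a 0 \<and> step b i a (\<lambda>j. d j - d i0) \<le> d i - d i0"
            using a by (intro bexI[of _ a]) auto
        qed
        show "0 \<le> d j - d i0" if "j \<le> m" for j using i0(2)[OF that] by simp
        show "- c * rho_min b Abar ^ j \<le> d j - d i0" for j
        proof (cases "m \<le> j")
          case True
          then show ?thesis
            using u_geometric[OF True] ep_bounds(1)[OF g, of j] \<open>d i0 \<le> 0\<close>
            by (simp add: d_def u_def r_def)
        next
          case False
          have "0 \<le> c * rho_min b Abar ^ j" using \<open>0 \<le> c\<close> r by (simp add: r_def)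
          then show ?thesis using i0(2)[of j] False by simp
        qed
      qed (use \<open>0 \<le> c\<close> in auto)
      then show ?thesis by simp
    qed
    have "d 0 = d i0"
      using super by (intro minimum_propagates_down[OF bounded_d min]) auto
    then show ?thesis using min[of i] d_zero by (simp add: d_def u_def)
  qed
  then show ?thesis by (simp add: optimal_iff[OF f] u_def)
qed

text \<open>
  Using \<open>a\<close> at \<open>n\<close> makes it impossible to move below \<open>n\<close>; the witness is the indicator of \<open>{..<n}\<close>,
  a supersolution for the policy changed in this way.
\<close>

lemma optimal_imp_ep_eq_0:
  assumes f: "f \<in> policies A" and opt: "optimal A b f"
    and "0 < n" "a \<in> A n" "b a 0 = 0" "n \<le> i"
  shows "ep b f i = 0"
proof -
  define g where "g = f(n := a)"
  have g: "g \<in> policies A" using f \<open>a \<in> A n\<close> by (simp add: g_def policies_def)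
  define x :: "nat \<Rightarrow> real" where "x j = (if j < n then 1 else 0)" for j
  have bounded_x: "bounded (range x)"
    by (rule boundedI[of _ 1]) (auto simp: x_def)
  have "ep b g i \<le> x i"
  proof (rule ep_le_supersolution[OF g _ bounded_x])
    fix j :: nat assume j: "0 < j"
    consider "j < n" | "j = n" | "n < j" by linarith
    then show "step b j (g j) x \<le> x j"
    proof cases
      case 1
      have "step b j (g j) x \<le> step b j (g j) (\<lambda>l. 1)"
        by (intro step_mono j policy_action[OF g] bounded_x) (auto simp: x_def)
      then show ?thesis using 1 step_const[OF j policy_action[OF g]] by (simp add: x_def)
    next
      case 2
      have "ptilde b (n - 1) n a = 0"
        using ptilde_pred[of n a] assms by simp
      then have "ptilde b l n a * x l = 0" for l
        using ptilde_below[of l n a] by (cases "l = n - 1") (auto simp: x_def)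
      then have "step b n a x = 0" by (simp only: step_def suminf_zero)
      then show ?thesis using 2 by (simp add: g_def x_def)
    next
      case 3
      then have "ptilde b l j (g j) * x l = 0" for l
        using ptilde_below[of l j "g j"] by (cases "l < n") (auto simp: x_def)
      then have "step b j (g j) x = 0" by (simp only: step_def suminf_zero)
      then show ?thesis using 3 by (simp add: x_def)
    qed
  qed (use \<open>0 < n\<close> in \<open>auto simp: x_def\<close>)
  then have "ep b g i \<le> 0"
    using \<open>n \<le> i\<close> by (simp add: x_def)
  moreover have "ep b f i \<le> ep b g i"
    using opt g \<open>0 < n\<close> \<open>n \<le> i\<close> unfolding optimal_iff[OF f] by simp
  ultimately show ?thesis using ep_bounds(1)[OF f, of i] by simp
qed

text \<open>
  No other policy can do better where \<open>ep b f\<close> is zero, so a negative difference could have its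
  minimum only at one of the states in \<open>{1..n}\<close>, from where it would propagate down to \<open>0\<close>.
\<close>

lemma solution_with_null_tail_optimal:
  assumes f: "f \<in> policies A"
    and positive: "\<And>i a. i \<in> {1..n} \<Longrightarrow> a \<in> A i \<Longrightarrow> 0 < b a 0"
    and tail: "\<And>i. n < i \<Longrightarrow> ep b f i = 0"
    and le_step: "\<And>i a. i \<in> {1..n} \<Longrightarrow> a \<in> A i \<Longrightarrow> ep b f i \<le> step b i a (ep b f)"
  shows "optimal A b f"
proof -
  have "ep b f i \<le> ep b g i" if g: "g \<in> policies A" for g i
  proof -
    define d where "d j = ep b g j - ep b f j" for j
    have bounded_d: "bounded (range d)"
      unfolding d_def by (intro bounded_minus_comp bounded_ep f g)
    have d_zero: "d 0 = 0" by (simp add: d_def ep_zero f g)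
    obtain i0 where i0: "i0 \<le> n" "\<And>j. j \<le> n \<Longrightarrow> d i0 \<le> d j"
      using ex_is_arg_min_if_finite[of "{..n}" d] by (auto simp: is_arg_min_linorder)
    have "d i0 \<le> 0" using i0(2)[of 0] d_zero by simp
    have min: "d i0 \<le> d j" for j
      using i0(2)[of j] \<open>d i0 \<le> 0\<close> tail[of j] ep_bounds(1)[OF g, of j]
      by (cases "j \<le> n") (auto simp: d_def)
    have "d 0 = d i0"
    proof (rule minimum_propagates_down[OF bounded_d min])
      fix j assume "0 < j" "j \<le> i0"
      then show "\<exists>a\<in>A j. 0 < b a 0 \<and> step b j a d \<le> d j"
        unfolding d_def using i0(1) policy_action[OF g, of j]
        by (intro superharmonic_at_ep_diff f g le_step positive) auto
    qed simp
    then show ?thesis using min[of i] d_zero by (simp add: d_def)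
  qed
  then show ?thesis by (simp add: optimal_iff[OF f])
qed

section \<open>Characterisation of optimal policies\<close>

lemma m_star_cases:
  shows "m_star A b m = m + 1 \<Longrightarrow> i \<in> {1..m} \<Longrightarrow> a \<in> A i \<Longrightarrow> 0 < b a 0"
    and "m_star A b m \<le> m \<Longrightarrow> 0 < m_star A b m"
    and "m_star A b m \<le> m \<Longrightarrow> \<exists>a\<in>A (m_star A b m). b a 0 = 0"
    and "m_star A b m \<le> m \<Longrightarrow> i \<in> {1..m_star A b m - 1} \<Longrightarrow> a \<in> A i \<Longrightarrow> 0 < b a 0"
proof -
  define M where "M = {i. 1 \<le> i \<and> i \<le> m \<and> Min ((\<lambda>a. b a 0) ` A i) = 0}"
  have m_star: "m_star A b m = (if M = {} then m + 1 else Min M)"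
    by (simp only: m_star_def M_def Let_def)
  have "finite M" unfolding M_def by (rule finite_subset[of _ "{..m}"]) auto
  have Min_M: "Min M \<in> M" if "M \<noteq> {}" using \<open>finite M\<close> that by simp
  have not_in: "0 < b a 0" if "i \<in> {1..m}" "i \<notin> M" "a \<in> A i" for i a
  proof -
    have finite: "finite ((\<lambda>a. b a 0) ` A i)" using actions[of i] by simp
    have "Min ((\<lambda>a. b a 0) ` A i) \<le> b a 0" using finite that by simp
    moreover have "0 \<le> Min ((\<lambda>a. b a 0) ` A i)"
      using finite that b_zero_nonneg by (subst Min_ge_iff) auto
    moreover have "Min ((\<lambda>a. b a 0) ` A i) \<noteq> 0" using that by (simp add: M_def)
    ultimately show ?thesis by linarith
  qed
  show "0 < b a 0" if "m_star A b m = m + 1" "i \<in> {1..m}" "a \<in> A i"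
  proof (rule not_in)
    have "i \<le> m" if "i \<in> M" for i using that by (simp add: M_def)
    then have "M = {}" using that(1) Min_M by (fastforce simp: m_star split: if_splits)
    then show "i \<notin> M" by simp
  qed (use that in auto)
  assume le: "m_star A b m \<le> m"
  then have "m_star A b m \<in> M" using Min_M by (auto simp: m_star split: if_splits)
  then show "0 < m_star A b m" by (simp add: M_def)
  have "Min ((\<lambda>a. b a 0) ` A (m_star A b m)) \<in> (\<lambda>a. b a 0) ` A (m_star A b m)"
    using actions[of "m_star A b m"] by (intro Min_in) auto
  then show "\<exists>a\<in>A (m_star A b m). b a 0 = 0"
    using \<open>m_star A b m \<in> M\<close> by (auto simp: M_def)
  assume i: "i \<in> {1..m_star A b m - 1}" "a \<in> A i"
  have "i \<notin> M"
  proof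
    assume "i \<in> M"
    then have "Min M \<le> i" "M \<noteq> {}" using \<open>finite M\<close> by auto
    then show False using i(1) by (auto simp: m_star)
  qed
  then show "0 < b a 0" using i le by (intro not_in) auto
qed

end

theorem theorem4p2:
  fixes A :: "nat \<Rightarrow> 'a set" and b :: "'a \<Rightarrow> nat \<Rightarrow> real" and m :: nat
    and Abar :: "'a set" and a_star :: 'a and r :: real
  assumes "controlled_branching A b m Abar"
    and "r = rho_min b Abar"
    and "a_star \<in> Abar" and "\<rho> b a_star = r"
  shows
    "(m_star A b m = m + 1 \<longrightarrow>
       (\<forall>f \<in> tail_policies A m a_star.
          optimal A b f \<longleftrightarrow>
            unique_solution_on {1..m}
              (\<lambda>x. (\<forall>i\<in>{1..m}. x i =
                      Min ((\<lambda>a. ptilde b 0 i a + (\<Sum>j=1..m - 1. ptilde b j i a * x j)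
                                + Lsum b m r i a * x m) ` A i)) \<and>
                   (\<forall>i\<in>{1..m}. 0 \<le> x i \<and> x i \<le> 1))
              (ep b f)
            \<and> (\<forall>i\<ge>m + 1. ep b f i = r ^ (i - m) * ep b f m)))
     \<and>
     (m_star A b m \<le> m \<longrightarrow>
       (\<forall>f \<in> tail_policies A m a_star.
          optimal A b f \<longleftrightarrow>
            unique_solution_on {1..m_star A b m - 1}
              (\<lambda>x. (\<forall>i\<in>{1..m_star A b m - 1}. x i =
                      Min ((\<lambda>a. ptilde b 0 i a
                                + (\<Sum>j=1..m_star A b m - 1. ptilde b j i a * x j)) ` A i)) \<and>
                   (\<forall>i\<in>{1..m_star A b m - 1}. 0 \<le> x i \<and> x i \<le> 1))
              (ep b f)
            \<and> (\<forall>i\<ge>m_star A b m. ep b f i = 0)))"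
proof -
  interpret controlled_branching A b m Abar by fact
  have r: "0 \<le> r" "r \<le> 1" using rho_min_bounds assms(2) by simp_all
  define t where "t j = r ^ (j - m)" for j
  have t: "0 \<le> t j" "t j \<le> 1" for j using r by (auto simp: t_def power_le_one)
  have system_geometric:
    "(\<lambda>x. (\<forall>i\<in>{1..m}. x i = Min ((\<lambda>a. ptilde b 0 i a + (\<Sum>j=1..m - 1. ptilde b j i a * x j)
             + Lsum b m r i a * x m) ` A i)) \<and> (\<forall>i\<in>{1..m}. 0 \<le> x i \<and> x i \<le> 1)) =
     solves m t"
    unfolding solves_def t_def
    by (intro ext arg_cong2[where f="(\<and>)"] ball_cong refl arg_cong2[where f="(=)"]
        arg_cong[where f=Min] image_cong step_extend_geometric[symmetric] r) auto
  have system_null: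
    "(\<lambda>x. (\<forall>i\<in>{1..n}. x i = Min ((\<lambda>a. ptilde b 0 i a + (\<Sum>j=1..n. ptilde b j i a * x j)) ` A i))
        \<and> (\<forall>i\<in>{1..n}. 0 \<le> x i \<and> x i \<le> 1)) = solves n (\<lambda>j. 0)" for n
    unfolding solves_def step_extend_null ..
  show ?thesis
    unfolding system_geometric system_null
  proof (intro conjI impI ballI)
    fix f
    assume m_star: "m_star A b m = m + 1" and f_tail: "f \<in> tail_policies A m a_star"
    have f: "f \<in> policies A" using f_tail by (simp add: tail_policies_def)
    have positive: "0 < b a 0" if "0 < i" "a \<in> A i" for i a
    proof (cases "i \<le> m")
      case False
      then have "a \<in> A m" using that actions_const[of i] actions_const[of m] by simp
      then show ?thesis using m_star_cases(1)[OF m_star, of m] m_pos by simp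
    qed (use m_star_cases(1)[OF m_star, of i] that in auto)
    have a_star: "a_star \<in> A m" using assms(3) by (simp add: Abar_eq)
    have "0 < b a_star 0" using positive[of m a_star] m_pos a_star by simp
    then have "r \<noteq> 0"
      using rho_is_least_root(3)[OF a_star] assms(4) by (auto simp: gen_fun_zero)
    then have r_pos: "0 < rho_min b Abar" using r assms(2) by simp
    have tail: "ep b f i = rho_min b Abar ^ (i - m) * ep b f m" if "m \<le> i" for i
      using f_tail assms \<open>0 < b a_star 0\<close> that
      by (intro ep_geometric_tail[of f a_star] f) (auto simp: tail_policies_def)
    have extend: "extend m t (ep b f) = ep b f"
    proof (rule ext)
      show "extend m t (ep b f) j = ep b f j" for j
        using tail[of j] by (auto simp: extend_def t_def ep_zero[OF f] assms(2))
    qed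
    have "optimal A b f \<longleftrightarrow> solves m t (ep b f)"
    proof
      assume "solves m t (ep b f)"
      then show "optimal A b f"
        by (intro solution_with_geometric_tail_optimal f positive r_pos tail
            solves_imp_le_step[OF _ extend]) auto
    qed (rule optimal_imp_solves[OF f _ extend])
    moreover have "\<forall>i\<ge>m + 1. ep b f i = r ^ (i - m) * ep b f m"
      unfolding assms(2) by (intro allI impI tail) simp
    moreover have "unique_solution_on {1..m} (solves m t) (ep b f) \<longleftrightarrow> solves m t (ep b f)"
      by (intro unique_solution_iff t positive) auto
    ultimately show "optimal A b f \<longleftrightarrow>
        unique_solution_on {1..m} (solves m t) (ep b f) \<and>
        (\<forall>i\<ge>m + 1. ep b f i = r ^ (i - m) * ep b f m)"
      by blast
  next
    fix f
    assume m_star: "m_star A b m \<le> m" and f_tail: "f \<in> tail_policies A m a_star"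
    have f: "f \<in> policies A" using f_tail by (simp add: tail_policies_def)
    define n where "n = m_star A b m - 1"
    have n: "m_star A b m = n + 1" using m_star_cases(2)[OF m_star] by (simp add: n_def)
    note positive = m_star_cases(4)[OF m_star, folded n_def]
    obtain a where a: "a \<in> A (m_star A b m)" "b a 0 = 0"
      using m_star_cases(3)[OF m_star] by blast
    have extend: "extend n (\<lambda>j. 0) (ep b f) = ep b f"
      if "\<forall>i\<ge>m_star A b m. ep b f i = 0"
      using that by (auto simp: extend_def ep_zero[OF f] n)
    have "unique_solution_on {1..n} (solves n (\<lambda>j. 0)) (ep b f) \<longleftrightarrow> solves n (\<lambda>j. 0) (ep b f)"
      using positive by (intro unique_solution_iff) auto
    moreover have "optimal A b f" if "solves n (\<lambda>j. 0) (ep b f)" "\<forall>i\<ge>m_star A b m. ep b f i = 0"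
      using that positive
      by (intro solution_with_null_tail_optimal[of f n] f
          solves_imp_le_step[OF that(1) extend[OF that(2)]]) (auto simp: n)
    moreover have "\<forall>i\<ge>m_star A b m. ep b f i = 0" if "optimal A b f"
      using optimal_imp_ep_eq_0[OF f that m_star_cases(2)[OF m_star] a] by blast
    ultimately show "optimal A b f \<longleftrightarrow>
        unique_solution_on {1..m_star A b m - 1} (solves (m_star A b m - 1) (\<lambda>j. 0)) (ep b f) \<and>
        (\<forall>i\<ge>m_star A b m. ep b f i = 0)"
      unfolding n_def[symmetric] using optimal_imp_solves[OF f _ extend] by blast
  qed
qed

end
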